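(* Let $m,n\ge 1$ and let $A\in\mathbb R^{m\times m}$, $B\in\mathbb R^{m\times n}$, $C\in\mathbb R^{n\times m}$, $D\in\mathbb R^{n\times n}$ be such that $$K=\begin{bmatrix} D & -C\\ -B & A\end{bmatrix}$$ is a regular singular $M$-matrix. Assume that the matrix $$H=\begin{bmatrix} I_n & 0\\ 0 & -I_m\end{bmatrix}K=\begin{bmatrix} D & -C\\ B & -A\end{bmatrix}$$ has only one linearly independent eigenvector corresponding to its zero eigenvalue, which has multiplicity $r\ge 1$ (that is, $\ker H$ is one-dimensional). Let $\begin{bmatrix} u_1 \\ u_2 \end{bmatrix}$ and $\begin{bmatrix} v_1 \\ v_2 \end{bmatrix}$, with $u_1,v_1\in\mathbb R^n$ and $u_2,v_2\in\mathbb R^m$, be nonnegative nonzero vectors such that $$K\begin{bmatrix} v_1 \\ v_2 \end{bmatrix}=0,\qquad \begin{bmatrix} u_1^T & u_2^T\end{bmatrix}K=0.$$ Let $\Phi\in\mathbb R^{m\times n}$ be the minimal nonnegative solution of the algebraic Riccati equation $$XCX-XD-AX+B=0,$$ and let $\Psi\in\mathbb R^{n\times m}$ be the minimal nonnegative solution of the dual equation $$YBY-YA-DY+C=0.$$ If $u_1^Tv_1\ne u_2^Tv_2$, then $I_m-\Phi\Psi$ and $I_n-\Psi\Phi$ are nonsingular $M$-matrices.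
   Context: All matrix and vector inequalities are entrywise: $A\ge 0$ means all entries are nonnegative, and $v>0$ means all entries are positive. $\rho(\cdot)$ denotes the spectral radius and $I_k$ the $k\times k$ identity matrix. A real square matrix is a $Z$-matrix if all its off-diagonal entries are nonpositive; any $Z$-matrix can be written as $sI-N$ with $s\in\mathbb R$ and $N\ge 0$. A $Z$-matrix written in this way is an $M$-matrix if $s\ge\rho(N)$; it is a singular $M$-matrix if $s=\rho(N)$ and a nonsingular $M$-matrix if $s>\rho(N)$. An $M$-matrix $M$ is called regular if $Mv\ge 0$ for some vector $v>0$. A minimal nonnegative solution of a matrix equation is a solution $X\ge 0$ such that $X\le Z$ (entrywise) for every solution $Z\ge 0$ of the equation. Known facts that make the statement meaningful: when $K$ is a regular $M$-matrix, the minimal nonnegative solutions $\Phi$ and $\Psi$ of the two equations exist; moreover $D-C\Phi$, $A-B\Psi$, $I_m-\Phi\Psi$ and $I_n-\Psi\Phi$ are regular $M$-matrices. When $K$ is a regular singular $M$-matrix and $H$ has only one linearly independent eigenvector for its zero eigenvalue, nonnegative nonzero vectors $\begin{bmatrix} u_1 \\ u_2 \end{bmatrix}$ and $\begin{bmatrix} v_1 \\ v_2 \end{bmatrix}$ as in the claim exist and are each unique up to a scalar multiple. *)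

theory Defs
  imports
    "Jordan_Normal_Form.Matrix"
    "Jordan_Normal_Form.Matrix_Kernel"
    "Jordan_Normal_Form.Char_Poly"
    "Jordan_Normal_Form.Spectral_Radius"
begin

(* On matrices and vectors the library's \<le> is the entrywise order, with equality of
   dimensions included.  The library's < is the strict part of \<le>, not entrywise
   strictness, so positivity of a vector is written out entry by entry. *)

definition real_spectral_radius :: "real mat \<Rightarrow> real" where
  "real_spectral_radius N = spectral_radius (map_mat complex_of_real N)"

definition Z_matrix :: "real mat \<Rightarrow> bool" where
  "Z_matrix M \<longleftrightarrow> square_mat M \<and>
     (\<forall>i < dim_row M. \<forall>j < dim_row M. i \<noteq> j \<longrightarrow> M $$ (i, j) \<le> 0)"

definition Z_splitting :: "real mat \<Rightarrow> real \<Rightarrow> real mat \<Rightarrow> bool" where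
  "Z_splitting M s N \<longleftrightarrow>
     N \<in> carrier_mat (dim_row M) (dim_row M) \<and>
     0\<^sub>m (dim_row M) (dim_row M) \<le> N \<and>
     M = s \<cdot>\<^sub>m 1\<^sub>m (dim_row M) - N"

lemma Z_matrix_iff_splitting: "Z_matrix M \<longleftrightarrow> (\<exists>s N. Z_splitting M s N)"
proof
  assume Z: "Z_matrix M"
  define n where "n = dim_row M"
  have dims: "dim_row M = n" "dim_col M = n"
    using Z by (auto simp: Z_matrix_def n_def)
  define s where "s = (\<Sum>i<n. \<bar>M $$ (i, i)\<bar>)"
  define N where "N = s \<cdot>\<^sub>m 1\<^sub>m n - M"
  have s: "M $$ (i, i) \<le> s" if "i < n" for i
  proof -
    have "\<bar>M $$ (i, i)\<bar> \<le> s"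
      unfolding s_def using that by (intro member_le_sum) auto
    then show ?thesis by simp
  qed
  have "Z_splitting M s N"
    unfolding Z_splitting_def
  proof (intro conjI)
    show "N \<in> carrier_mat (dim_row M) (dim_row M)"
      using dims by (auto simp: N_def)
    show "0\<^sub>m (dim_row M) (dim_row M) \<le> N"
      using Z dims s by (auto simp: N_def less_eq_mat_def Z_matrix_def)
    show "M = s \<cdot>\<^sub>m 1\<^sub>m (dim_row M) - N"
      by (rule eq_matI) (use dims in \<open>auto simp: N_def\<close>)
  qed
  then show "\<exists>s N. Z_splitting M s N" by blast
next
  assume "\<exists>s N. Z_splitting M s N"
  then obtain s N where N: "N \<in> carrier_mat (dim_row M) (dim_row M)"
    and pos: "0\<^sub>m (dim_row M) (dim_row M) \<le> N"
    and M: "M = s \<cdot>\<^sub>m 1\<^sub>m (dim_row M) - N"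
    by (auto simp: Z_splitting_def)
  have "dim_col M = dim_row M"
    using arg_cong[OF M, of dim_col] N by simp
  moreover have "M $$ (i, j) \<le> 0" if "i < dim_row M" "j < dim_row M" "i \<noteq> j" for i j
    using arg_cong[OF M, of "\<lambda>X. X $$ (i, j)"] N pos that
    by (auto simp: less_eq_mat_def)
  ultimately show "Z_matrix M" by (auto simp: Z_matrix_def)
qed

definition M_matrix :: "real mat \<Rightarrow> bool" where
  "M_matrix M \<longleftrightarrow> Z_matrix M \<and> (\<exists>s N. Z_splitting M s N \<and> s \<ge> real_spectral_radius N)"

definition singular_M_matrix :: "real mat \<Rightarrow> bool" where
  "singular_M_matrix M \<longleftrightarrow>
     Z_matrix M \<and> (\<exists>s N. Z_splitting M s N \<and> s = real_spectral_radius N)"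

definition nonsingular_M_matrix :: "real mat \<Rightarrow> bool" where
  "nonsingular_M_matrix M \<longleftrightarrow>
     Z_matrix M \<and> (\<exists>s N. Z_splitting M s N \<and> s > real_spectral_radius N)"

definition regular_M_matrix :: "real mat \<Rightarrow> bool" where
  "regular_M_matrix M \<longleftrightarrow> M_matrix M \<and>
     (\<exists>v \<in> carrier_vec (dim_col M).
        (\<forall>i < dim_col M. v $ i > 0) \<and> 0\<^sub>v (dim_row M) \<le> M *\<^sub>v v)"

definition minimal_nonneg_solution ::
    "nat \<Rightarrow> nat \<Rightarrow> (real mat \<Rightarrow> real mat) \<Rightarrow> real mat \<Rightarrow> bool" where
  "minimal_nonneg_solution m n F X \<longleftrightarrow>
     X \<in> carrier_mat m n \<and> 0\<^sub>m m n \<le> X \<and> F X = 0\<^sub>m m n \<and>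
     (\<forall>Z \<in> carrier_mat m n. 0\<^sub>m m n \<le> Z \<and> F Z = 0\<^sub>m m n \<longrightarrow> X \<le> Z)"

end

theory Submission
  imports Defs
begin

text \<open>
  Both spectral radii in question are less than 1; the argument works with row vectors and avoids
  eigenvalue counting. Write M1 = A - \<Phi> C and M2 = D - \<Psi> B, and let q = (q1, q2) > 0 be a vector with
  K q \<ge> 0.

  The minimal solution \<Phi> is the limit of a monotone iteration that starts at 0. Since every iterate
  satisfies the corresponding bound, p = (p1, p2) with p2 \<ge> 0 and K p \<ge> 0 forces \<Phi> p1 \<le> p2.
  So \<Phi> q1 \<le> q2, \<Phi> v1 \<le> v2, and dually \<Psi> q2 \<le> q1, \<Psi> v2 \<le> v1. The iteration also shows that for e > 0 the
  matrix M1 + e, if it is invertible, has a nonnegative inverse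
  (\<open>minimal_solution_shifted_loop_monotone_mat\<close>), because the same holds with \<Phi> replaced by an
  iterate X, where q2 - X q1 is a positive vector that A - X C + e maps to a positive vector.
  The same applies to M2.

  Suppose \<Phi> \<Psi> has spectral radius at least 1. As \<Phi> \<Psi> q2 \<le> q2 and q2 > 0, there is a nonzero x \<ge> 0
  with x \<Phi> \<Psi> = x (\<open>left_fixed_vector_if_spectral_radius_ge_1\<close>). Put y = x \<Phi>, so that x = y \<Psi>.
  The rows [-\<Phi>, I] and [I, -\<Psi>] span spaces invariant under right multiplication by H:
  [-\<Phi>, I] H = -M1 [-\<Phi>, I] and [I, -\<Psi>] H = M2 [I, -\<Psi>]. The row vector
  g = (-y, x) = x [-\<Phi>, I] = -y [I, -\<Psi>] lies in both. By the inequalities for v,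
  g v = x (v2 - \<Phi> v1) \<ge> 0 and g v = y (\<Psi> v2 - v1) \<le> 0, so g v = 0.

  The condition on u1 v1 and u2 v2 says that the left null vector u = (u1, -u2) of H is not
  orthogonal to the right null vector v. As the kernel of H is spanned by v, the matrix H + v u is
  therefore invertible (\<open>simple_kernel_rank_one_update_det\<close>), and it acts like H on row vectors
  orthogonal to v. For small e > 0 the equation f (H + v u - e) = -g has the solution f = w [-\<Phi>, I]
  where w (M1 + e) = x, so w \<ge> 0, and f (H + v u + e) = -g has the solution f = w' [I, -\<Psi>] where
  w' (M2 + e) = y, so w' \<ge> 0. The first solution has the sign pattern (-, +) and the second (+, -),
  yet for e \<rightarrow> 0 both tend to the solution of h (H + v u) = -g. So h = 0, hence g = 0 and x = 0, a
  contradiction (\<open>nonneg_left_fixed_vector_eq_zero\<close>). A left fixed vector y of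
  \<Psi> \<Phi> gives the left fixed vector y \<Psi> of \<Phi> \<Psi>, which settles the second product.

  In the formal text row vectors appear as column vectors multiplied by transposed matrices.
\<close>

section \<open>Entrywise inequalities\<close>

lemma zero_le_vec_iff: "0\<^sub>v n \<le> v \<longleftrightarrow> v \<in> carrier_vec n \<and> (\<forall>i<n. 0 \<le> v $ i)"
  for v :: "real vec"
  unfolding less_eq_vec_def by (metis carrier_vecD carrier_vecI index_zero_vec)

lemma zero_le_mat_iff: "0\<^sub>m nr nc \<le> X \<longleftrightarrow> X \<in> carrier_mat nr nc \<and> (\<forall>i<nr. \<forall>j<nc. 0 \<le> X $$ (i,j))"
  for X :: "real mat"
  unfolding less_eq_mat_def by (metis carrier_matD carrier_matI index_zero_mat)

lemma mult_mat_index: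
  assumes "X \<in> carrier_mat nr k" "Y \<in> carrier_mat k nc" "i < nr" "j < nc"
  shows "(X * Y) $$ (i, j) = (\<Sum>l<k. X $$ (i, l) * Y $$ (l, j))"
  using assms by (auto simp: scalar_prod_def atLeast0LessThan)

lemma mult_mat_vec_index:
  assumes "X \<in> carrier_mat nr k" "v \<in> carrier_vec k" "i < nr"
  shows "(X *\<^sub>v v) $ i = (\<Sum>l<k. X $$ (i, l) * v $ l)"
  using assms by (auto simp: scalar_prod_def atLeast0LessThan)

lemma smult_mat_mult_vec:
  fixes X :: "'a :: comm_semiring_0 mat"
  assumes "X \<in> carrier_mat nr nc" "v \<in> carrier_vec nc"
  shows "(a \<cdot>\<^sub>m X) *\<^sub>v v = a \<cdot>\<^sub>v (X *\<^sub>v v)"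
  using assms by (intro eq_vecI) auto

lemma mult_mat_mono:
  fixes X :: "real mat"
  assumes "X \<in> carrier_mat nr k" "0\<^sub>m nr k \<le> X" "X \<le> X'" "0\<^sub>m k nc \<le> Y" "Y \<le> Y'"
  shows "X * Y \<le> X' * Y'"
proof -
  have c: "X' \<in> carrier_mat nr k" "Y \<in> carrier_mat k nc" "Y' \<in> carrier_mat k nc"
    using assms by (auto simp: less_eq_mat_def)
  have X': "0 \<le> X' $$ (i, l)" if "i < nr" "l < k" for i l
  proof -
    have "0 \<le> X $$ (i, l)" "X $$ (i, l) \<le> X' $$ (i, l)"
      using assms(2,3) c that by (auto simp: zero_le_mat_iff less_eq_mat_def)
    then show ?thesis by linarith
  qed
  show ?thesis
    unfolding less_eq_mat_def
  proof (intro conjI allI impI)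
    fix i j assume "i < dim_row (X' * Y')" "j < dim_col (X' * Y')"
    then have ij: "i < nr" "j < nc" using c by auto
    show "(X * Y) $$ (i, j) \<le> (X' * Y') $$ (i, j)"
      unfolding mult_mat_index[OF assms(1) c(2) ij] mult_mat_index[OF c(1) c(3) ij]
      using assms c ij by (intro sum_mono mult_mono) (auto simp: less_eq_mat_def X')
  qed (use assms c in auto)
qed

lemma zero_le_mult_mat:
  fixes X :: "real mat"
  assumes "0\<^sub>m nr k \<le> X" "0\<^sub>m k nc \<le> Y"
  shows "0\<^sub>m nr nc \<le> X * Y"
proof -
  have c: "X \<in> carrier_mat nr k" "Y \<in> carrier_mat k nc"
    using assms by (auto simp: zero_le_mat_iff)
  then have "(X * Y) $$ (i, j) \<ge> 0" if "i < nr" "j < nc" for i j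
    unfolding mult_mat_index[OF c that] using assms that
    by (intro sum_nonneg mult_nonneg_nonneg) (auto simp: zero_le_mat_iff)
  with c show ?thesis unfolding zero_le_mat_iff by auto
qed

lemma mult_mat_vec_mono:
  fixes X :: "real mat"
  assumes "0\<^sub>m nr k \<le> X" "v \<in> carrier_vec k" "v \<le> w"
  shows "X *\<^sub>v v \<le> X *\<^sub>v w"
proof -
  have c: "X \<in> carrier_mat nr k" "w \<in> carrier_vec k"
    using assms by (auto simp: zero_le_mat_iff less_eq_vec_def)
  have "(X *\<^sub>v v) $ i \<le> (X *\<^sub>v w) $ i" if "i < nr" for i
    unfolding mult_mat_vec_index[OF c(1) assms(2) that] mult_mat_vec_index[OF c that]
    using assms that c by (intro sum_mono mult_left_mono) (auto simp: zero_le_mat_iff less_eq_vec_def)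
  with c show ?thesis unfolding less_eq_vec_def by auto
qed

lemma zero_le_mult_mat_vec:
  fixes X :: "real mat"
  assumes "0\<^sub>m nr k \<le> X" "0\<^sub>v k \<le> v"
  shows "0\<^sub>v nr \<le> X *\<^sub>v v"
proof -
  have "X *\<^sub>v 0\<^sub>v k \<le> X *\<^sub>v v" using assms by (intro mult_mat_vec_mono) auto
  moreover have "X *\<^sub>v 0\<^sub>v k = 0\<^sub>v nr" using assms(1) by (auto simp: zero_le_mat_iff)
  ultimately show ?thesis by simp
qed

lemma scalar_prod_mono:
  fixes x :: "real vec"
  assumes "0\<^sub>v n \<le> x" "v \<le> w" "w \<in> carrier_vec n"
  shows "x \<bullet> v \<le> x \<bullet> w"
  using assms unfolding scalar_prod_def zero_le_vec_iff less_eq_vec_def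
  by (auto intro!: sum_mono mult_left_mono)

(* limits *)

section \<open>Limits of linear systems\<close>

lemma det_tendsto:
  fixes M :: "'b \<Rightarrow> real mat"
  assumes M: "\<And>k. M k \<in> carrier_mat n n" "L \<in> carrier_mat n n"
    and lim: "\<And>i j. i < n \<Longrightarrow> j < n \<Longrightarrow> ((\<lambda>k. M k $$ (i, j)) \<longlongrightarrow> L $$ (i, j)) F"
  shows "((\<lambda>k. det (M k)) \<longlongrightarrow> det L) F"
  unfolding det_def'[OF M(1)] det_def'[OF M(2)]
proof (intro tendsto_sum tendsto_mult tendsto_const tendsto_prod lim)
  fix p i assume "p \<in> {p. p permutes {0..<n}}" "i \<in> {0..<n}"
  then show "i < n" "p i < n" using permutes_in_image[of p "{0..<n}" i] by auto
qed

text \<open>By Cramer's rule the entries of a solution are quotients of determinants, which are continuous;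
  the limit system has to be nonsingular, the approximating ones become so by themselves.\<close>
lemma solution_tendsto:
  fixes M :: "'b \<Rightarrow> real mat"
  assumes M: "\<And>k. M k \<in> carrier_mat n n" "L \<in> carrier_mat n n"
    and lim: "\<And>i j. i < n \<Longrightarrow> j < n \<Longrightarrow> ((\<lambda>k. M k $$ (i, j)) \<longlongrightarrow> L $$ (i, j)) F"
    and det: "det L \<noteq> 0"
    and x: "eventually (\<lambda>k. x k \<in> carrier_vec n \<and> M k *\<^sub>v x k = L *\<^sub>v z) F" and z: "z \<in> carrier_vec n"
    and i: "i < n"
  shows "((\<lambda>k. x k $ i) \<longlongrightarrow> z $ i) F"
proof -
  let ?b = "L *\<^sub>v z"
  have dl: "((\<lambda>k. det (M k)) \<longlongrightarrow> det L) F" by (rule det_tendsto[OF M lim])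
  have "((\<lambda>k. det (replace_col (M k) ?b i)) \<longlongrightarrow> det (replace_col L ?b i)) F"
    by (rule det_tendsto[where n = n]) (use M lim z i carrier_matD[OF M(1)] carrier_matD[OF M(2)] in \<open>auto simp: replace_col_def\<close>)
  then have "((\<lambda>k. det (replace_col (M k) ?b i) / det (M k)) \<longlongrightarrow> det (replace_col L ?b i) / det L) F"
    using dl det by (intro tendsto_divide)
  moreover have "det (replace_col L ?b i) / det L = z $ i"
    using det cramer_lemma_mat[OF M(2) z i] by simp
  moreover have "eventually (\<lambda>k. det (replace_col (M k) ?b i) / det (M k) = x k $ i) F"
    using x tendsto_imp_eventually_ne[OF dl det]
  proof eventually_elim
    case (elim k)
    then show ?case using cramer_lemma_mat[OF M(1), of "x k" i k] i by simp
  qed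
  ultimately show ?thesis using Lim_transform_eventually by fastforce
qed

lemma eventually_shift_det_nonzero:
  assumes L: "L \<in> carrier_mat N N" and det: "det L \<noteq> 0"
  shows "eventually (\<lambda>e. det ((c * e) \<cdot>\<^sub>m 1\<^sub>m N + L) \<noteq> 0) (at_right (0 :: real))"
proof (rule tendsto_imp_eventually_ne)
  show "((\<lambda>e. det ((c * e) \<cdot>\<^sub>m 1\<^sub>m N + L)) \<longlongrightarrow> det L) (at_right 0)"
  proof (rule det_tendsto[where n = N])
    fix i j assume "i < N" "j < N"
    then show "((\<lambda>e. ((c * e) \<cdot>\<^sub>m 1\<^sub>m N + L) $$ (i, j)) \<longlongrightarrow> L $$ (i, j)) (at_right 0)"
      using L by (auto intro!: tendsto_eq_intros)
  qed (use L in auto)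
qed (rule det)

lemma shifted_solution_tendsto:
  assumes L: "L \<in> carrier_mat N N" and det: "det L \<noteq> 0"
    and x: "eventually (\<lambda>e. x e \<in> carrier_vec N \<and> ((c * e) \<cdot>\<^sub>m 1\<^sub>m N + L) *\<^sub>v x e = L *\<^sub>v z) (at_right (0 :: real))"
    and z: "z \<in> carrier_vec N" and i: "i < N"
  shows "((\<lambda>e. x e $ i) \<longlongrightarrow> z $ i) (at_right 0)"
proof (rule solution_tendsto[OF _ L _ det x z i])
  fix i j assume "i < N" "j < N"
  then show "((\<lambda>e. ((c * e) \<cdot>\<^sub>m 1\<^sub>m N + L) $$ (i, j)) \<longlongrightarrow> L $$ (i, j)) (at_right 0)"
    using L by (auto intro!: tendsto_eq_intros)
qed (use L in auto)

lemma det_nonzero_solve: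
  fixes M :: "'a :: field mat"
  assumes M: "M \<in> carrier_mat n n" and d: "det M \<noteq> 0" and b: "b \<in> carrier_vec n"
  obtains x where "x \<in> carrier_vec n" "M *\<^sub>v x = b"
proof
  note a = adj_mat[OF M]
  let ?x = "inverse (det M) \<cdot>\<^sub>v (adj_mat M *\<^sub>v b)"
  show "?x \<in> carrier_vec n" using a b by auto
  have "M *\<^sub>v ?x = inverse (det M) \<cdot>\<^sub>v ((M * adj_mat M) *\<^sub>v b)"
    using M a b by (simp add: mult_mat_vec[OF M] assoc_mult_mat_vec[OF M a(1) b, symmetric] del: assoc_mult_mat_vec)
  also have "\<dots> = b" using a b d by (auto intro!: eq_vecI)
  finally show "M *\<^sub>v ?x = b" .
qed

lemma kernel_dim_1_multiple:
  fixes M :: "'a :: field mat"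
  assumes M: "M \<in> carrier_mat nr nc" and k1: "kernel_dim M = 1"
    and v: "v \<in> carrier_vec nc" "v \<noteq> 0\<^sub>v nc" "M *\<^sub>v v = 0\<^sub>v nr"
    and w: "w \<in> carrier_vec nc" "M *\<^sub>v w = 0\<^sub>v nr"
  obtains c where "w = c \<cdot>\<^sub>v v"
proof -
  interpret kernel nr nc M by unfold_locales (rule M)
  obtain bas where fin: "finite bas" and bas: "basis bas"
    using kernel_basis_exists[OF M] by blast
  have "card bas = 1" using k1 Ker.dim_basis[OF fin bas] by simp
  then obtain b where b: "bas = {b}" by (auto simp: card_1_singleton_iff)
  have bk: "b \<in> mat_kernel M" using bas b by (auto simp: Ker.basis_def)
  have mult: "\<exists>a. z = a \<cdot>\<^sub>v b" if "z \<in> mat_kernel M" for z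
  proof -
    have "z \<in> span {b}" using that bas b by (auto simp: Ker.basis_def)
    then obtain a where a: "z = lincomb a {b}"
      using Ker.finite_in_span[of "{b}" z] bk by auto
    have "z = a b \<cdot>\<^sub>v b"
    proof (rule eq_vecI)
      fix i assume "i < dim_vec (a b \<cdot>\<^sub>v b)"
      then have "i < nc" using bk M by (auto simp: mat_kernel_def)
      then show "z $ i = (a b \<cdot>\<^sub>v b) $ i"
        using lincomb_index[of i "{b}" a] bk M unfolding a by (auto simp: mat_kernel_def)
    qed (use that bk M in \<open>auto simp: mat_kernel_def\<close>)
    then show ?thesis by blast
  qed
  have "v \<in> mat_kernel M" "w \<in> mat_kernel M" using v w M by (auto intro: mat_kernelI)
  then obtain a c where a: "v = a \<cdot>\<^sub>v b" and c: "w = c \<cdot>\<^sub>v b"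
    using mult by blast
  have "a \<noteq> 0" using a v bk M by (auto simp: mat_kernel_def)
  then have "w = (c / a) \<cdot>\<^sub>v v" using a c by (simp add: smult_smult_assoc)
  then show ?thesis by (rule that)
qed

lemma mult_mat_tendsto:
  fixes X Y :: "'b \<Rightarrow> real mat"
  assumes X: "\<And>k. X k \<in> carrier_mat nr l" "X' \<in> carrier_mat nr l"
    and Y: "\<And>k. Y k \<in> carrier_mat l nc" "Y' \<in> carrier_mat l nc"
    and "\<And>i j. i < nr \<Longrightarrow> j < l \<Longrightarrow> ((\<lambda>k. X k $$ (i, j)) \<longlongrightarrow> X' $$ (i, j)) F"
    and "\<And>i j. i < l \<Longrightarrow> j < nc \<Longrightarrow> ((\<lambda>k. Y k $$ (i, j)) \<longlongrightarrow> Y' $$ (i, j)) F"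
    and ij: "i < nr" "j < nc"
  shows "((\<lambda>k. (X k * Y k) $$ (i, j)) \<longlongrightarrow> (X' * Y') $$ (i, j)) F"
  unfolding mult_mat_index[OF X(1) Y(1) ij] mult_mat_index[OF X(2) Y(2) ij]
  using assms by (intro tendsto_sum tendsto_mult) auto

section \<open>Monotone matrices\<close>

text \<open>Collatz's notion of a monotone matrix, that is, an invertible matrix with nonnegative inverse. Stated
  through the order, it needs no inverse and follows directly from a minimum principle.\<close>
definition monotone_mat :: "nat \<Rightarrow> real mat \<Rightarrow> bool" where
  "monotone_mat n M \<longleftrightarrow> M \<in> carrier_mat n n \<and> (\<forall>z \<in> carrier_vec n. 0\<^sub>v n \<le> M *\<^sub>v z \<longrightarrow> 0\<^sub>v n \<le> z)"

text \<open>A minimum principle for Z-matrices. If z had a negative entry, look at an index i that minimises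
  z_i / p_i, with minimum -c. Then z + c p is nonnegative and vanishes at i, so row i of M maps it to a
  value at most 0, although M z is nonnegative and M p positive at i.\<close>
lemma monotone_mat_if_positive_vector:
  assumes M: "M \<in> carrier_mat n n"
    and off: "\<And>i j. i < n \<Longrightarrow> j < n \<Longrightarrow> i \<noteq> j \<Longrightarrow> M $$ (i, j) \<le> 0"
    and p: "p \<in> carrier_vec n" "\<And>i. i < n \<Longrightarrow> 0 < p $ i" "\<And>i. i < n \<Longrightarrow> 0 < (M *\<^sub>v p) $ i"
  shows "monotone_mat n M"
  unfolding monotone_mat_def
proof (intro conjI ballI impI M)
  fix z :: "real vec" assume z: "z \<in> carrier_vec n" and Mz: "0\<^sub>v n \<le> M *\<^sub>v z"
  show "0\<^sub>v n \<le> z"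
  proof (rule ccontr)
    assume "\<not> 0\<^sub>v n \<le> z"
    then obtain i0 where i0: "i0 < n" "z $ i0 < 0" using z by (auto simp: zero_le_vec_iff not_le)
    obtain i where i: "i < n" and min: "\<And>j. j < n \<Longrightarrow> z $ i / p $ i \<le> z $ j / p $ j"
      using ex_min_if_finite[of "(\<lambda>i. z $ i / p $ i) ` {..<n}"] i0 by (auto simp: not_less)
    \<comment> \<open>the least c for which z + c p is nonnegative\<close>
    define c where "c = - (z $ i / p $ i)"
    have "z $ i0 / p $ i0 < 0" using i0 p by (simp add: divide_neg_pos)
    then have c: "c > 0" using min[OF i0(1)] by (simp add: c_def)
    have le: "0 \<le> z $ j + c * p $ j" if "j < n" for j
      using min[OF that] p(2)[OF that] by (simp add: c_def field_simps)
    have eq: "z $ i + c * p $ i = 0"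
      using p(2)[OF i] by (simp add: c_def)
    have "0 < (M *\<^sub>v z) $ i + c * (M *\<^sub>v p) $ i"
      using Mz i p(3)[OF i] c by (intro add_nonneg_pos) (auto simp: zero_le_vec_iff)
    also have "\<dots> = (\<Sum>j<n. M $$ (i, j) * (z $ j + c * p $ j))"
      unfolding mult_mat_vec_index[OF M z i] mult_mat_vec_index[OF M p(1) i]
      by (simp add: sum_distrib_left sum.distrib algebra_simps)
    also have "\<dots> \<le> 0"
    proof (rule sum_nonpos)
      fix j assume j: "j \<in> {..<n}"
      show "M $$ (i, j) * (z $ j + c * p $ j) \<le> 0"
        using off[of i j] i j le[of j] eq by (cases "j = i") (auto intro: mult_nonpos_nonneg)
    qed
    finally show False by simp
  qed
qed

lemma monotone_mat_det_nonzero: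
  assumes "monotone_mat n M"
  shows "det M \<noteq> 0"
proof
  assume "det M = 0"
  have M: "M \<in> carrier_mat n n" using assms by (simp add: monotone_mat_def)
  with \<open>det M = 0\<close> obtain z where z: "z \<in> carrier_vec n" "z \<noteq> 0\<^sub>v n" "M *\<^sub>v z = 0\<^sub>v n"
    using det_0_iff_vec_prod_zero_field by blast
  have "M *\<^sub>v (- z) = - (M *\<^sub>v z)" using M z(1) by (auto intro!: eq_vecI)
  then have "M *\<^sub>v (- z) = 0\<^sub>v n" using z by auto
  then have "0\<^sub>v n \<le> z" "0\<^sub>v n \<le> - z"
    using assms z unfolding monotone_mat_def by auto
  then have "z = 0\<^sub>v n" by (intro eq_vecI) (force simp: zero_le_vec_iff)+
  with z show False by simp
qed

text \<open>An entry of w is the pairing of the image of w under the transpose with a column of the inverse of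
  M, and both are nonnegative.\<close>
lemma monotone_mat_transpose:
  assumes "monotone_mat n M"
  shows "monotone_mat n M\<^sup>T"
  unfolding monotone_mat_def
proof (intro conjI ballI impI)
  have M: "M \<in> carrier_mat n n" using assms by (simp add: monotone_mat_def)
  then show "M\<^sup>T \<in> carrier_mat n n" by simp
  fix w assume w: "w \<in> carrier_vec n" and Mw: "0\<^sub>v n \<le> M\<^sup>T *\<^sub>v w"
  have "0 \<le> w $ i" if i: "i < n" for i
  proof -
    obtain z where z: "z \<in> carrier_vec n" "M *\<^sub>v z = unit_vec n i"
      using det_nonzero_solve[OF M monotone_mat_det_nonzero[OF assms], of "unit_vec n i"] by auto
    have "0\<^sub>v n \<le> (unit_vec n i :: real vec)" unfolding zero_le_vec_iff by (auto simp: unit_vec_def)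
    then have z0: "0\<^sub>v n \<le> z" using assms z by (auto simp: monotone_mat_def)
    have "0 \<le> (M\<^sup>T *\<^sub>v w) \<bullet> z"
      using scalar_prod_mono[OF Mw z0 z(1)] Mw by (auto simp: zero_le_vec_iff)
    also have "\<dots> = w \<bullet> (M *\<^sub>v z)" by (rule transpose_vec_mult_scalar[OF M z(1) w])
    also have "\<dots> = w $ i" using z i w by simp
    finally show ?thesis .
  qed
  with w show "0\<^sub>v n \<le> w" by (auto simp: zero_le_vec_iff)
qed

text \<open>Solutions of M x = b with b nonnegative are nonnegative along the sequence and converge; the
  determinant condition is essential, as a limit of monotone matrices can be singular.\<close>
lemma monotone_mat_limit:
  assumes M: "\<And>k. monotone_mat n (M k)" and L: "L \<in> carrier_mat n n" "det L \<noteq> 0"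
    and lim: "\<And>i j. i < n \<Longrightarrow> j < n \<Longrightarrow> ((\<lambda>k. M k $$ (i, j)) \<longlongrightarrow> L $$ (i, j)) F"
    and F: "F \<noteq> bot"
  shows "monotone_mat n L"
  unfolding monotone_mat_def
proof (intro conjI ballI impI L(1))
  fix z :: "real vec" assume z: "z \<in> carrier_vec n" and Lz: "0\<^sub>v n \<le> L *\<^sub>v z"
  have Mc: "M k \<in> carrier_mat n n" for k using M by (simp add: monotone_mat_def)
  have "\<exists>x \<in> carrier_vec n. M k *\<^sub>v x = L *\<^sub>v z" for k
    using det_nonzero_solve[OF Mc monotone_mat_det_nonzero[OF M], of "L *\<^sub>v z"] Lz
    unfolding zero_le_vec_iff by blast
  then obtain x where x: "\<And>k. x k \<in> carrier_vec n" "\<And>k. M k *\<^sub>v x k = L *\<^sub>v z" by metis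
  have "0\<^sub>v n \<le> x k" for k
    using M[of k] x[of k] Lz unfolding monotone_mat_def by auto
  then have "0 \<le> x k $ i" if "i < n" for k i
    using that by (simp add: zero_le_vec_iff)
  moreover have "((\<lambda>k. x k $ i) \<longlongrightarrow> z $ i) F" if "i < n" for i
    by (rule solution_tendsto[OF Mc L(1) lim L(2) _ z that]) (use x in auto)
  ultimately have "0 \<le> z $ i" if "i < n" for i
    using that F by (intro tendsto_lowerbound[of "\<lambda>k. x k $ i" _ F]) auto
  with z show "0\<^sub>v n \<le> z" by (auto simp: zero_le_vec_iff)
qed

section \<open>The monotone iteration for the Riccati equation\<close>

text \<open>The sign conditions say that [D, -C; -B, A] is a Z-matrix. The dual equation is the same locale with
  the roles of A and D, of B and C, and of m and n exchanged.\<close>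
locale riccati =
  fixes m n :: nat and A B C D :: "real mat"
  assumes A: "A \<in> carrier_mat m m" and D: "D \<in> carrier_mat n n"
    and B0: "0\<^sub>m m n \<le> B" and C0: "0\<^sub>m n m \<le> C"
    and A_off: "\<And>i j. i < m \<Longrightarrow> j < m \<Longrightarrow> i \<noteq> j \<Longrightarrow> A $$ (i, j) \<le> 0"
    and D_off: "\<And>i j. i < n \<Longrightarrow> j < n \<Longrightarrow> i \<noteq> j \<Longrightarrow> D $$ (i, j) \<le> 0"
begin

lemma B: "B \<in> carrier_mat m n" and C: "C \<in> carrier_mat n m"
  using B0 C0 by (auto simp: zero_le_mat_iff)

abbreviation residual :: "real mat \<Rightarrow> real mat" where
  "residual X \<equiv> X * C * X - X * D - A * X + B"

text \<open>Any positive number that dominates the diagonals of A and D serves; this one is explicit.\<close>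
definition shift :: real where
  "shift = 1 + (\<Sum>i<m. \<bar>A $$ (i, i)\<bar>) + (\<Sum>i<n. \<bar>D $$ (i, i)\<bar>)"

lemma le_shift: "i < m \<Longrightarrow> A $$ (i, i) \<le> shift" "i < n \<Longrightarrow> D $$ (i, i) \<le> shift" and shift_pos: "0 < shift"
proof -
  have nn: "0 \<le> (\<Sum>i<m. \<bar>A $$ (i, i)\<bar>)" "0 \<le> (\<Sum>i<n. \<bar>D $$ (i, i)\<bar>)"
    by (auto intro: sum_nonneg)
  then show "0 < shift" unfolding shift_def by linarith
  have "\<bar>A $$ (i, i)\<bar> \<le> (\<Sum>i<m. \<bar>A $$ (i, i)\<bar>)" if "i < m"
    using that by (intro member_le_sum) auto
  with nn show "A $$ (i, i) \<le> shift" if "i < m"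
    using that unfolding shift_def by linarith
  have "\<bar>D $$ (i, i)\<bar> \<le> (\<Sum>i<n. \<bar>D $$ (i, i)\<bar>)" if "i < n"
    using that by (intro member_le_sum) auto
  with nn show "D $$ (i, i) \<le> shift" if "i < n"
    using that unfolding shift_def by linarith
qed

definition NA :: "real mat" where "NA = shift \<cdot>\<^sub>m 1\<^sub>m m - A"
definition ND :: "real mat" where "ND = shift \<cdot>\<^sub>m 1\<^sub>m n - D"

lemma NA0: "0\<^sub>m m m \<le> NA" and ND0: "0\<^sub>m n n \<le> ND"
  using A D le_shift A_off D_off unfolding zero_le_mat_iff NA_def ND_def by auto

text \<open>Writing A and D as a multiple of the identity minus a nonnegative matrix turns the Riccati equation
  into a fixed point equation whose right hand side is monotone on nonnegative matrices.\<close>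
definition step :: "real mat \<Rightarrow> real mat" where
  "step X = (1 / (2 * shift)) \<cdot>\<^sub>m (X * C * X + X * ND + NA * X + B)"

lemma residual_carrier: "X \<in> carrier_mat m n \<Longrightarrow> residual X \<in> carrier_mat m n"
  using A B C D by auto

lemma step_carrier: "X \<in> carrier_mat m n \<Longrightarrow> step X \<in> carrier_mat m n"
  using B by (auto simp: step_def)

lemma step_eq_residual:
  assumes X: "X \<in> carrier_mat m n"
  shows "step X = X + (1 / (2 * shift)) \<cdot>\<^sub>m residual X"
proof -
  have "X * ND = shift \<cdot>\<^sub>m X - X * D"
    unfolding ND_def using X D
    by (subst mult_minus_distrib_mat[of _ m n _ n]) (auto simp: mult_smult_distrib[of _ m n _ n])
  moreover have "NA * X = shift \<cdot>\<^sub>m X - A * X"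
    unfolding NA_def using X A
    by (subst minus_mult_distrib_mat[of _ m m _ _ n]) (auto simp: mult_smult_assoc_mat[of _ m m _ n])
  moreover have "X * C * X \<in> carrier_mat m n" "X * D \<in> carrier_mat m n" "A * X \<in> carrier_mat m n"
    using X A C D by auto
  ultimately show ?thesis
    unfolding step_def using X B shift_pos
    by (intro eq_matI) (auto simp del: index_mult_mat simp: field_simps)
qed

lemma step_fixpoint_iff:
  assumes X: "X \<in> carrier_mat m n"
  shows "step X = X \<longleftrightarrow> residual X = 0\<^sub>m m n"
proof -
  have "X + (1 / (2 * shift)) \<cdot>\<^sub>m R = X \<longleftrightarrow> R = 0\<^sub>m m n" if R: "R \<in> carrier_mat m n" for R
    using X R shift_pos by (auto simp: mat_eq_iff)
  then show ?thesis using step_eq_residual[OF X] residual_carrier[OF X] by simp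
qed

lemma zero_le_residual_iff:
  assumes X: "X \<in> carrier_mat m n"
  shows "0\<^sub>m m n \<le> residual X \<longleftrightarrow> X \<le> step X"
proof -
  have "0\<^sub>m m n \<le> R \<longleftrightarrow> X \<le> X + (1 / (2 * shift)) \<cdot>\<^sub>m R" if R: "R \<in> carrier_mat m n" for R
    using X R shift_pos by (auto simp: less_eq_mat_def zero_le_divide_iff)
  then show ?thesis using step_eq_residual[OF X] residual_carrier[OF X] by simp
qed

lemma step_mono:
  assumes "0\<^sub>m m n \<le> X" "X \<le> Y"
  shows "step X \<le> step Y"
proof -
  have X: "X \<in> carrier_mat m n" and Y: "Y \<in> carrier_mat m n"
    using assms by (auto simp: zero_le_mat_iff less_eq_mat_def)
  have "0\<^sub>m m m \<le> X * C" by (rule zero_le_mult_mat[OF assms(1) C0])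
  moreover have "X * C \<le> Y * C" by (rule mult_mat_mono[OF X assms C0 order_refl])
  ultimately have "X * C * X \<le> Y * C * Y"
    using mult_mat_mono[of "X * C" m m "Y * C" n X Y] X C assms by auto
  moreover have "X * ND \<le> Y * ND" by (rule mult_mat_mono[OF X assms ND0 order_refl])
  moreover have "NA * X \<le> NA * Y"
    using NA0 by (intro mult_mat_mono[OF _ _ order_refl assms]) (auto simp: zero_le_mat_iff)
  moreover have "ND \<in> carrier_mat n n" "NA \<in> carrier_mat m m" using ND0 NA0 by (auto simp: zero_le_mat_iff)
  ultimately show ?thesis
    using X Y B C shift_pos unfolding step_def less_eq_mat_def
    by (auto simp del: index_mult_mat(1) intro!: divide_right_mono add_mono)
qed

lemma zero_le_step:
  assumes "0\<^sub>m m n \<le> X"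
  shows "0\<^sub>m m n \<le> step X"
proof -
  have "0\<^sub>m m n \<le> step (0\<^sub>m m n)" 
    using B0 shift_pos A C D unfolding step_eq_residual[OF zero_carrier_mat] 
    by (auto simp: zero_le_mat_iff)
  also have "\<dots> \<le> step X" using assms by (intro step_mono) auto
  finally show ?thesis .
qed

definition iterate :: "nat \<Rightarrow> real mat" where
  "iterate k = (step ^^ k) (0\<^sub>m m n)"

lemma iterate_Suc: "iterate (Suc k) = step (iterate k)" and iterate_0: "iterate 0 = 0\<^sub>m m n"
  by (simp_all add: iterate_def)

lemma zero_le_iterate: "0\<^sub>m m n \<le> iterate k"
  by (induction k) (auto simp: iterate_0 iterate_Suc zero_le_step)

lemma iterate_carrier: "iterate k \<in> carrier_mat m n"
  using zero_le_iterate[of k] by (simp add: zero_le_mat_iff)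

lemma iterate_le_Suc: "iterate k \<le> iterate (Suc k)"
proof (induction k)
  case 0
  show ?case using zero_le_iterate[of 1] by (simp add: iterate_0)
next
  case (Suc k)
  then show ?case using step_mono[OF zero_le_iterate] by (simp add: iterate_Suc)
qed

lemma zero_le_residual_iterate: "0\<^sub>m m n \<le> residual (iterate k)"
  using iterate_le_Suc[of k] by (simp add: zero_le_residual_iff[OF iterate_carrier] iterate_Suc)

lemma iterate_le_solution:
  assumes "0\<^sub>m m n \<le> Z" "residual Z = 0\<^sub>m m n"
  shows "iterate k \<le> Z"
proof (induction k)
  case 0
  show ?case using assms by (simp add: iterate_0)
next
  case (Suc k)
  have "step Z = Z" using assms by (auto simp: step_fixpoint_iff zero_le_mat_iff)
  then show ?case using step_mono[OF zero_le_iterate Suc] by (simp add: iterate_Suc)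
qed

lemma step_tendsto:
  assumes X: "\<And>k. X k \<in> carrier_mat m n" and Y: "Y \<in> carrier_mat m n"
    and lim: "\<And>i j. i < m \<Longrightarrow> j < n \<Longrightarrow> (\<lambda>k. X k $$ (i, j)) \<longlonglongrightarrow> Y $$ (i, j)"
    and ij: "i < m" "j < n"
  shows "(\<lambda>k. step (X k) $$ (i, j)) \<longlonglongrightarrow> step Y $$ (i, j)"
proof -
  have ND: "ND \<in> carrier_mat n n" and NA: "NA \<in> carrier_mat m m"
    using ND0 NA0 by (auto simp: zero_le_mat_iff)
  have exp: "step Z $$ (i, j) = ((Z * C * Z) $$ (i, j) + (Z * ND) $$ (i, j) + (NA * Z) $$ (i, j) + B $$ (i, j)) / (2 * shift)"
    if "Z \<in> carrier_mat m n" for Z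
    unfolding step_def using that ij A B C D ND NA by (simp del: index_mult_mat(1))
  have XC: "(\<lambda>k. (X k * C) $$ (i, j)) \<longlonglongrightarrow> (Y * C) $$ (i, j)" if "i < m" "j < m" for i j
    by (rule mult_mat_tendsto[where nr = m and nc = m and l = n]) (use X Y C lim that  in auto)
  have XC': "X k * C \<in> carrier_mat m m" for k by (rule mult_carrier_mat[OF X C])
  have "(\<lambda>k. (X k * C * X k) $$ (i, j)) \<longlonglongrightarrow> (Y * C * Y) $$ (i, j)"
    by (rule mult_mat_tendsto[OF XC' mult_carrier_mat[OF Y C] X Y XC lim ij])
  moreover have "(\<lambda>k. (X k * ND) $$ (i, j)) \<longlonglongrightarrow> (Y * ND) $$ (i, j)"
    by (rule mult_mat_tendsto[where nr = m and nc = n and l = n]) (use X Y ND lim ij  in auto)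
  moreover have "(\<lambda>k. (NA * X k) $$ (i, j)) \<longlonglongrightarrow> (NA * Y) $$ (i, j)"
    by (rule mult_mat_tendsto[where nr = m and nc = n and l = m]) (use X Y NA lim ij  in auto)
  ultimately show ?thesis
    unfolding exp[OF X] exp[OF Y] using shift_pos by (intro tendsto_intros) auto
qed

text \<open>The iterates increase and stay below \<Phi>, so they converge; the limit is a nonnegative solution below
  \<Phi>, and minimality of \<Phi> makes it equal to \<Phi>.\<close>
lemma iterate_tendsto:
  assumes min: "minimal_nonneg_solution m n residual \<Phi>" and ij: "i < m" "j < n"
  shows "(\<lambda>k. iterate k $$ (i, j)) \<longlonglongrightarrow> \<Phi> $$ (i, j)"
proof -
  have \<Phi>: "\<Phi> \<in> carrier_mat m n" "0\<^sub>m m n \<le> \<Phi>" "residual \<Phi> = 0\<^sub>m m n"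
    and least: "\<And>Z. Z \<in> carrier_mat m n \<Longrightarrow> 0\<^sub>m m n \<le> Z \<Longrightarrow> residual Z = 0\<^sub>m m n \<Longrightarrow> \<Phi> \<le> Z"
    using min unfolding minimal_nonneg_solution_def by auto
  note ub = iterate_le_solution[OF \<Phi>(2,3)]
  have "convergent (\<lambda>k. iterate k $$ (i, j))" if "i < m" "j < n" for i j
  proof (rule Bseq_monoseq_convergent)
    have "incseq (\<lambda>k. iterate k $$ (i, j))"
      using iterate_le_Suc that iterate_carrier
      by (intro incseq_SucI) (auto simp: less_eq_mat_def carrier_matD[OF iterate_carrier])
    then show "monoseq (\<lambda>k. iterate k $$ (i, j))" by (simp add: incseq_imp_monoseq)
    have "norm (iterate k $$ (i, j)) \<le> \<Phi> $$ (i, j)" for k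
      using ub[of k] zero_le_iterate[of k] that \<Phi>(1) by (simp add: less_eq_mat_def)
    then show "Bseq (\<lambda>k. iterate k $$ (i, j))" by (rule BseqI')
  qed
  then have conv: "(\<lambda>k. iterate k $$ (i, j)) \<longlonglongrightarrow> lim (\<lambda>k. iterate k $$ (i, j))" if "i < m" "j < n" for i j
    using that by (simp add: convergent_LIMSEQ_iff)
  define Y where "Y = mat m n (\<lambda>(i, j). lim (\<lambda>k. iterate k $$ (i, j)))"
  have Yc: "Y \<in> carrier_mat m n" by (simp add: Y_def)
  have Y: "(\<lambda>k. iterate k $$ (i, j)) \<longlonglongrightarrow> Y $$ (i, j)" if "i < m" "j < n" for i j
    using conv[OF that] that by (simp add: Y_def)
  have "step Y = Y"
  proof (rule eq_matI)
    fix i j assume "i < dim_row Y" "j < dim_col Y"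
    then have ij: "i < m" "j < n" using Yc by auto
    have "(\<lambda>k. iterate (Suc k) $$ (i, j)) \<longlonglongrightarrow> step Y $$ (i, j)"
      unfolding iterate_Suc by (rule step_tendsto[OF iterate_carrier Yc Y ij])
    moreover have "(\<lambda>k. iterate (Suc k) $$ (i, j)) \<longlonglongrightarrow> Y $$ (i, j)"
      using Y[OF ij] by (rule LIMSEQ_Suc)
    ultimately show "step Y $$ (i, j) = Y $$ (i, j)" by (rule LIMSEQ_unique)
  qed (use step_carrier[OF Yc] Yc in auto)
  then have resY: "residual Y = 0\<^sub>m m n" using step_fixpoint_iff[OF Yc] by simp
  have "0 \<le> Y $$ (i, j)" "Y $$ (i, j) \<le> \<Phi> $$ (i, j)" if "i < m" "j < n" for i j
  proof -
    have "0 \<le> iterate k $$ (i, j)" "iterate k $$ (i, j) \<le> \<Phi> $$ (i, j)" for k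
      using ub[of k] zero_le_iterate[of k] that \<Phi>(1) by (simp_all add: less_eq_mat_def)
    then show "0 \<le> Y $$ (i, j)" "Y $$ (i, j) \<le> \<Phi> $$ (i, j)"
      using Y[OF that] by (meson LIMSEQ_le_const LIMSEQ_le_const2)+
  qed
  then have "0\<^sub>m m n \<le> Y" "Y \<le> \<Phi>" using Yc \<Phi>(1) by (auto simp: less_eq_mat_def)
  then have "Y = \<Phi>" using least[OF Yc _ resY] by simp
  with Y ij show ?thesis by simp
qed

lemma residual_mult_vec:
  assumes X: "X \<in> carrier_mat m n" and p: "p \<in> carrier_vec n"
  shows "residual X *\<^sub>v p = X *\<^sub>v (C *\<^sub>v (X *\<^sub>v p)) - X *\<^sub>v (D *\<^sub>v p) - A *\<^sub>v (X *\<^sub>v p) + B *\<^sub>v p"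
proof -
  have c: "X * C * X \<in> carrier_mat m n" "X * D \<in> carrier_mat m n" "A * X \<in> carrier_mat m n"
    "X * C \<in> carrier_mat m m"
    using X A C D by auto
  have "(P - Q - R + B) *\<^sub>v p = P *\<^sub>v p - Q *\<^sub>v p - R *\<^sub>v p + B *\<^sub>v p"
    if "P \<in> carrier_mat m n" "Q \<in> carrier_mat m n" "R \<in> carrier_mat m n" for P Q R
    using that B p by (simp add: add_mult_distrib_mat_vec[of _ m n] minus_mult_distrib_mat_vec[of _ m n] minus_carrier_mat)
  from this[OF c(1-3)]
  have "residual X *\<^sub>v p = (X * C * X) *\<^sub>v p - (X * D) *\<^sub>v p - (A * X) *\<^sub>v p + B *\<^sub>v p" .
  moreover have "(X * C * X) *\<^sub>v p = X *\<^sub>v (C *\<^sub>v (X *\<^sub>v p))"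
    using assoc_mult_mat_vec[OF c(4) X p] assoc_mult_mat_vec[OF X C, of "X *\<^sub>v p"] X p by simp
  moreover have "(X * D) *\<^sub>v p = X *\<^sub>v (D *\<^sub>v p)" "(A * X) *\<^sub>v p = A *\<^sub>v (X *\<^sub>v p)"
    using assoc_mult_mat_vec[OF X D p] assoc_mult_mat_vec[OF A X p] by simp_all
  ultimately show ?thesis by (simp only:)
qed

text \<open>One step moves X p1 at most half of the way to p2: by K1 the quadratic term is absorbed by X D p1, by
  K2 the residual applied to p1 is then at most A (p2 - X p1), and A is at most the shift times the
  identity.
  The gap left over is what keeps the inequality strict in \<open>iterate_mult_vec_less\<close>.\<close>
lemma step_mult_vec_le:
  assumes X0: "0\<^sub>m m n \<le> X" 
    and p1: "p1 \<in> carrier_vec n" and p2: "p2 \<in> carrier_vec m"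
    and K1: "C *\<^sub>v p2 \<le> D *\<^sub>v p1" and K2: "B *\<^sub>v p1 \<le> A *\<^sub>v p2"
    and Xp: "X *\<^sub>v p1 \<le> p2" and i: "i < m"
  shows "2 * (step X *\<^sub>v p1) $ i \<le> (X *\<^sub>v p1) $ i + p2 $ i"
proof -
  have X: "X \<in> carrier_mat m n" using X0 by (simp add: zero_le_mat_iff)
  have Xp1: "X *\<^sub>v p1 \<in> carrier_vec m" using X p1 by auto
  define w where "w = p2 - X *\<^sub>v p1"
  have w: "0\<^sub>v m \<le> w" using Xp Xp1 p2 by (auto simp: w_def less_eq_vec_def)
  then have wc: "w \<in> carrier_vec m" by (simp add: zero_le_vec_iff)
  have "C *\<^sub>v (X *\<^sub>v p1) \<le> D *\<^sub>v p1"
    using mult_mat_vec_mono[OF C0 Xp1 Xp] K1 by (rule order_trans)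
  then have "X *\<^sub>v (C *\<^sub>v (X *\<^sub>v p1)) \<le> X *\<^sub>v (D *\<^sub>v p1)"
    using C Xp1 by (intro mult_mat_vec_mono[OF X0]) auto
  then have le1: "(X *\<^sub>v (C *\<^sub>v (X *\<^sub>v p1))) $ i \<le> (X *\<^sub>v (D *\<^sub>v p1)) $ i"
    using X i by (simp add: less_eq_vec_def del: index_mult_mat_vec)
  have le2: "(B *\<^sub>v p1) $ i \<le> (A *\<^sub>v p2) $ i"
    using K2 A i by (simp add: less_eq_vec_def del: index_mult_mat_vec)
  have "0\<^sub>v m \<le> NA *\<^sub>v w" by (rule zero_le_mult_mat_vec[OF NA0 w])
  moreover have "NA *\<^sub>v w = shift \<cdot>\<^sub>v w - A *\<^sub>v w"
    unfolding NA_def using A wc by (auto simp: minus_mult_distrib_mat_vec[of _ m m] intro!: eq_vecI)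
  moreover have "A *\<^sub>v w = A *\<^sub>v p2 - A *\<^sub>v (X *\<^sub>v p1)"
    unfolding w_def by (rule mult_minus_distrib_mat_vec[OF A p2 Xp1])
  ultimately have le3: "(A *\<^sub>v p2) $ i - (A *\<^sub>v (X *\<^sub>v p1)) $ i \<le> shift * (p2 $ i - (X *\<^sub>v p1) $ i)"
    using i A wc Xp1 p2 X by (auto simp: zero_le_vec_iff w_def simp del: index_mult_mat_vec)
  have "(residual X *\<^sub>v p1) $ i \<le> shift * (p2 $ i - (X *\<^sub>v p1) $ i)"
    unfolding residual_mult_vec[OF X p1] using le1 le2 le3 A B X i
    by (simp del: index_mult_mat_vec)
  then have "(residual X *\<^sub>v p1) $ i / (2 * shift) \<le> (p2 $ i - (X *\<^sub>v p1) $ i) / 2"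
    using shift_pos by (simp add: field_simps)
  moreover have "step X *\<^sub>v p1 = X *\<^sub>v p1 + (1 / (2 * shift)) \<cdot>\<^sub>v (residual X *\<^sub>v p1)"
    unfolding step_eq_residual[OF X] using X residual_carrier[OF X] p1
    by (subst add_mult_distrib_mat_vec[of _ m n]) (auto simp: smult_mat_mult_vec)
  ultimately show ?thesis
    using i X B by (simp del: index_mult_mat_vec add: field_simps)
qed


lemma iterate_mult_vec_le:
  assumes p1: "p1 \<in> carrier_vec n" and p2: "0\<^sub>v m \<le> p2"
    and K1: "C *\<^sub>v p2 \<le> D *\<^sub>v p1" and K2: "B *\<^sub>v p1 \<le> A *\<^sub>v p2"
  shows "iterate k *\<^sub>v p1 \<le> p2"
proof (induction k)
  case 0
  have "0\<^sub>m m n *\<^sub>v p1 = 0\<^sub>v m" using p1 by auto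
  then show ?case using p2 by (simp add: iterate_0)
next
  case (Suc k)
  have p2c: "p2 \<in> carrier_vec m" using p2 by (simp add: zero_le_vec_iff)
  have "(step (iterate k) *\<^sub>v p1) $ i \<le> p2 $ i" if "i < m" for i
  proof -
    have "(iterate k *\<^sub>v p1) $ i \<le> p2 $ i"
      using Suc that p2c by (simp add: less_eq_vec_def del: index_mult_mat_vec)
    then show ?thesis
      using step_mult_vec_le[OF zero_le_iterate p1 p2c K1 K2 Suc that] by linarith
  qed
  then show ?case
    using p2c step_carrier[OF iterate_carrier, of k]
    by (simp add: less_eq_vec_def iterate_Suc del: index_mult_mat_vec)
qed

lemma iterate_mult_vec_less:
  assumes p1: "p1 \<in> carrier_vec n" and p2: "p2 \<in> carrier_vec m" "\<And>i. i < m \<Longrightarrow> 0 < p2 $ i"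
    and K1: "C *\<^sub>v p2 \<le> D *\<^sub>v p1" and K2: "B *\<^sub>v p1 \<le> A *\<^sub>v p2" and i: "i < m"
  shows "(iterate k *\<^sub>v p1) $ i < p2 $ i"
proof (induction k)
  case 0
  then show ?case using p1 p2(2)[OF i] i by (simp add: iterate_0)
next
  case (Suc k)
  have "0\<^sub>v m \<le> p2" using p2 by (simp add: zero_le_vec_iff less_imp_le)
  then have "iterate k *\<^sub>v p1 \<le> p2" by (rule iterate_mult_vec_le[OF p1 _ K1 K2])
  then have "2 * (step (iterate k) *\<^sub>v p1) $ i \<le> (iterate k *\<^sub>v p1) $ i + p2 $ i"
    by (rule step_mult_vec_le[OF zero_le_iterate p1 p2(1) K1 K2 _ i])
  with Suc show ?case unfolding iterate_Suc by linarith
qed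

text \<open>For a vector p = (p1, p2) with [D, -C; -B, A] p \<ge> 0; it is used both for a positive
  such vector and for the null vector v.\<close>
lemma minimal_solution_mult_vec_le:
  assumes min: "minimal_nonneg_solution m n residual \<Phi>"
    and p1: "p1 \<in> carrier_vec n" and p2: "0\<^sub>v m \<le> p2"
    and K1: "C *\<^sub>v p2 \<le> D *\<^sub>v p1" and K2: "B *\<^sub>v p1 \<le> A *\<^sub>v p2"
  shows "\<Phi> *\<^sub>v p1 \<le> p2"
proof -
  have \<Phi>: "\<Phi> \<in> carrier_mat m n" using min by (simp add: minimal_nonneg_solution_def)
  have p2c: "p2 \<in> carrier_vec m" using p2 by (simp add: zero_le_vec_iff)
  have "(\<Phi> *\<^sub>v p1) $ i \<le> p2 $ i" if i: "i < m" for i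
  proof (rule LIMSEQ_le_const2)
    show "(\<lambda>k. (iterate k *\<^sub>v p1) $ i) \<longlonglongrightarrow> (\<Phi> *\<^sub>v p1) $ i"
      unfolding mult_mat_vec_index[OF iterate_carrier p1 i] mult_mat_vec_index[OF \<Phi> p1 i]
      by (intro tendsto_intros iterate_tendsto[OF min i]) auto
    show "\<exists>N. \<forall>k\<ge>N. (iterate k *\<^sub>v p1) $ i \<le> p2 $ i"
      using iterate_mult_vec_le[OF p1 p2 K1 K2] i p2c
      by (auto simp: less_eq_vec_def simp del: index_mult_mat_vec)
  qed
  then show ?thesis using \<Phi> p2c by (simp add: less_eq_vec_def del: index_mult_mat_vec)
qed

text \<open>For a solution X, the matrix A - X C is, up to sign, the action of H on the invariant row space of
  [-X, I].\<close>
definition shifted_loop :: "real \<Rightarrow> real mat \<Rightarrow> real mat" where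
  "shifted_loop e X = e \<cdot>\<^sub>m 1\<^sub>m m + (A - X * C)"

lemma shifted_loop_carrier: "X \<in> carrier_mat m n \<Longrightarrow> shifted_loop e X \<in> carrier_mat m m"
  using A C by (auto simp: shifted_loop_def)

text \<open>The vector w = q2 - X q1 witnesses monotonicity. The equation for the residual rearranges to
  (A - X C) w = residual X q1 + (A q2 - B q1) + X (D q1 - C q2), a sum of nonnegative vectors, and
  the shift by e makes it positive. For this X must be a subsolution and w strictly positive, which
  holds for the iterates but can fail for the minimal solution itself.\<close>
lemma shifted_loop_monotone_mat:
  assumes e: "0 < e" and X0: "0\<^sub>m m n \<le> X" and res: "0\<^sub>m m n \<le> residual X"
    and q1: "0\<^sub>v n \<le> q1" and q2: "q2 \<in> carrier_vec m"
    and K1: "C *\<^sub>v q2 \<le> D *\<^sub>v q1" and K2: "B *\<^sub>v q1 \<le> A *\<^sub>v q2"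
    and Xq: "\<And>i. i < m \<Longrightarrow> (X *\<^sub>v q1) $ i < q2 $ i"
  shows "monotone_mat m (shifted_loop e X)"
proof -
  have X: "X \<in> carrier_mat m n" using X0 by (simp add: zero_le_mat_iff)
  have q1c: "q1 \<in> carrier_vec n" using q1 by (simp add: zero_le_vec_iff)
  have Xq1: "X *\<^sub>v q1 \<in> carrier_vec m" using X q1c by auto
  have XC: "X * C \<in> carrier_mat m m" using X C by auto
  define w where "w = q2 - X *\<^sub>v q1"
  have w: "w \<in> carrier_vec m" using q2 Xq1 by (simp add: w_def)
  have w_pos: "0 < w $ i" if "i < m" for i
    using Xq[OF that] that q2 X by (simp add: w_def del: index_mult_mat_vec)
  show ?thesis
  proof (rule monotone_mat_if_positive_vector[OF shifted_loop_carrier[OF X] _ w w_pos])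
    fix i assume i: "i < m"
    have "shifted_loop e X *\<^sub>v w = e \<cdot>\<^sub>v w + (A *\<^sub>v w - X *\<^sub>v (C *\<^sub>v w))"
      unfolding shifted_loop_def using A XC w X C
      by (simp add: add_mult_distrib_mat_vec[of _ m m] minus_mult_distrib_mat_vec[of _ m m]
          smult_mat_mult_vec[of _ m m] minus_carrier_mat)
    moreover have "A *\<^sub>v w = A *\<^sub>v q2 - A *\<^sub>v (X *\<^sub>v q1)"
      unfolding w_def by (rule mult_minus_distrib_mat_vec[OF A q2 Xq1])
    moreover have "C *\<^sub>v w = C *\<^sub>v q2 - C *\<^sub>v (X *\<^sub>v q1)"
      unfolding w_def by (rule mult_minus_distrib_mat_vec[OF C q2 Xq1])
    moreover have "X *\<^sub>v (C *\<^sub>v q2 - C *\<^sub>v (X *\<^sub>v q1)) = X *\<^sub>v (C *\<^sub>v q2) - X *\<^sub>v (C *\<^sub>v (X *\<^sub>v q1))"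
      using C q2 Xq1 by (intro mult_minus_distrib_mat_vec[OF X]) auto
    ultimately have Mw: "(shifted_loop e X *\<^sub>v w) $ i = e * w $ i + ((A *\<^sub>v q2) $ i - (A *\<^sub>v (X *\<^sub>v q1)) $ i
        - ((X *\<^sub>v (C *\<^sub>v q2)) $ i - (X *\<^sub>v (C *\<^sub>v (X *\<^sub>v q1))) $ i))"
      using i w A X by (simp del: index_mult_mat_vec)
    have "0\<^sub>v m \<le> residual X *\<^sub>v q1" by (rule zero_le_mult_mat_vec[OF res q1])
    then have r: "0 \<le> (X *\<^sub>v (C *\<^sub>v (X *\<^sub>v q1))) $ i - (X *\<^sub>v (D *\<^sub>v q1)) $ i - (A *\<^sub>v (X *\<^sub>v q1)) $ i + (B *\<^sub>v q1) $ i"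
      unfolding residual_mult_vec[OF X q1c] using i A B X
      by (simp add: zero_le_vec_iff del: index_mult_mat_vec)
    have "X *\<^sub>v (C *\<^sub>v q2) \<le> X *\<^sub>v (D *\<^sub>v q1)"
      using C q2 by (intro mult_mat_vec_mono[OF X0 _ K1]) auto
    then have le1: "(X *\<^sub>v (C *\<^sub>v q2)) $ i \<le> (X *\<^sub>v (D *\<^sub>v q1)) $ i"
      using X i by (simp add: less_eq_vec_def del: index_mult_mat_vec)
    have le2: "(B *\<^sub>v q1) $ i \<le> (A *\<^sub>v q2) $ i"
      using K2 A i by (simp add: less_eq_vec_def del: index_mult_mat_vec)
    have "0 < e * w $ i" using e w_pos[OF i] by simp
    then show "0 < (shifted_loop e X *\<^sub>v w) $ i" unfolding Mw using r le1 le2 by linarith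
  next
    fix i j assume ij: "i < m" "j < m" "i \<noteq> j"
    have "0 \<le> (X * C) $$ (i, j)"
      using zero_le_mult_mat[OF X0 C0] ij by (simp add: zero_le_mat_iff del: index_mult_mat(1))
    then show "shifted_loop e X $$ (i, j) \<le> 0"
      using A_off[OF ij] ij A XC X C by (simp add: shifted_loop_def del: index_mult_mat(1))
  qed
qed

text \<open>Monotonicity passes from the iterates to their limit, at the price of the determinant condition.\<close>
lemma minimal_solution_shifted_loop_monotone_mat:
  assumes min: "minimal_nonneg_solution m n residual \<Phi>"
    and e: "0 < e" and det: "det (shifted_loop e \<Phi>) \<noteq> 0"
    and q1: "0\<^sub>v n \<le> q1" and q2: "q2 \<in> carrier_vec m" "\<And>i. i < m \<Longrightarrow> 0 < q2 $ i"
    and K1: "C *\<^sub>v q2 \<le> D *\<^sub>v q1" and K2: "B *\<^sub>v q1 \<le> A *\<^sub>v q2"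
  shows "monotone_mat m (shifted_loop e \<Phi>)"
proof (rule monotone_mat_limit[where M = "\<lambda>k. shifted_loop e (iterate k)" and F = sequentially])
  have \<Phi>: "\<Phi> \<in> carrier_mat m n" using min by (simp add: minimal_nonneg_solution_def)
  have q1c: "q1 \<in> carrier_vec n" using q1 by (simp add: zero_le_vec_iff)
  show "monotone_mat m (shifted_loop e (iterate k))" for k
    by (rule shifted_loop_monotone_mat[OF e zero_le_iterate zero_le_residual_iterate q1 q2(1) K1 K2
          iterate_mult_vec_less[OF q1c q2 K1 K2]])
  show "shifted_loop e \<Phi> \<in> carrier_mat m m" by (rule shifted_loop_carrier[OF \<Phi>])
  fix i j assume ij: "i < m" "j < m"
  have eq: "shifted_loop e X $$ (i, j) = (e \<cdot>\<^sub>m 1\<^sub>m m) $$ (i, j) + (A $$ (i, j) - (X * C) $$ (i, j))"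
    if "X \<in> carrier_mat m n" for X
    using that ij A C by (simp add: shifted_loop_def del: index_mult_mat(1))
  have "(\<lambda>k. (iterate k * C) $$ (i, j)) \<longlonglongrightarrow> (\<Phi> * C) $$ (i, j)"
    by (rule mult_mat_tendsto[OF iterate_carrier \<Phi> C C iterate_tendsto[OF min] tendsto_const ij])
  then show "(\<lambda>k. shifted_loop e (iterate k) $$ (i, j)) \<longlonglongrightarrow> shifted_loop e \<Phi> $$ (i, j)"
    unfolding eq[OF iterate_carrier] eq[OF \<Phi>] by (intro tendsto_intros)
qed (use det in auto)

end

section \<open>Left fixed vectors of nonnegative matrices\<close>

text \<open>Take the entrywise modulus x of a left eigenvector for an eigenvalue of modulus at least 1. The triangle
  inequality gives x \<le> x N. Pairing the difference d = x N - x with the positive vector q gives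
  x (N q - q) \<le> 0, so d = 0. Thus a fixed vector is obtained without Perron-Frobenius theory.\<close>
lemma left_fixed_vector_if_spectral_radius_ge_1:
  assumes k: "k > 0" and N0: "0\<^sub>m k k \<le> N"
    and q: "q \<in> carrier_vec k" "\<And>i. i < k \<Longrightarrow> 0 < q $ i" and Nq: "N *\<^sub>v q \<le> q"
    and rho: "1 \<le> real_spectral_radius N"
  obtains x where "0\<^sub>v k \<le> x" "x \<noteq> 0\<^sub>v k" "N\<^sup>T *\<^sub>v x = x"
proof -
  have N: "N \<in> carrier_mat k k" using N0 by (simp add: zero_le_mat_iff)
  define Nc where "Nc = map_mat complex_of_real N"
  have Nc: "Nc \<in> carrier_mat k k" "Nc\<^sup>T \<in> carrier_mat k k" using N by (auto simp: Nc_def)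
  obtain \<mu> where "eigenvalue Nc \<mu>" and \<mu>: "1 \<le> cmod \<mu>"
    using spectral_radius_mem_max(1)[OF Nc(1) k] rho
    by (auto simp: real_spectral_radius_def Nc_def spectrum_def)
  then have "eigenvalue Nc\<^sup>T \<mu>"
    using Nc by (simp add: eigenvalue_root_char_poly)
  then obtain y where y: "y \<in> carrier_vec k" "y \<noteq> 0\<^sub>v k" "Nc\<^sup>T *\<^sub>v y = \<mu> \<cdot>\<^sub>v y"
    using Nc by (auto simp: eigenvalue_def eigenvector_def)
  define x where "x = vec k (\<lambda>i. cmod (y $ i))"
  have x: "x \<in> carrier_vec k" by (simp add: x_def)
  have x0: "0\<^sub>v k \<le> x" unfolding zero_le_vec_iff by (auto simp: x_def)
  have NT: "N\<^sup>T \<in> carrier_mat k k" using N by simp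
  have sub: "x $ i \<le> (N\<^sup>T *\<^sub>v x) $ i" if i: "i < k" for i
  proof -
    have "x $ i \<le> cmod \<mu> * cmod (y $ i)"
      using \<mu> i mult_right_mono[OF \<mu>, of "cmod (y $ i)"] by (simp add: x_def)
    also have "\<dots> = cmod ((Nc\<^sup>T *\<^sub>v y) $ i)" unfolding y(3) using y(1) i by (simp add: norm_mult)
    also have "\<dots> \<le> (\<Sum>j<k. cmod (Nc\<^sup>T $$ (i, j) * y $ j))"
      unfolding mult_mat_vec_index[OF Nc(2) y(1) i] by (rule norm_sum)
    also have "\<dots> = (N\<^sup>T *\<^sub>v x) $ i"
      unfolding mult_mat_vec_index[OF NT x i] using i N N0
      by (intro sum.cong) (auto simp: norm_mult Nc_def x_def zero_le_mat_iff)
    finally show ?thesis .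
  qed
  \<comment> \<open>d is nonnegative, and its pairing with the positive vector q is at most 0\<close>
  define d where "d = N\<^sup>T *\<^sub>v x - x"
  have dc: "d \<in> carrier_vec k" using NT x by (simp add: d_def)
  have d0: "0 \<le> d $ i" if "i < k" for i
    using sub[OF that] that x N by (simp add: d_def del: index_mult_mat_vec)
  have "d \<bullet> q = (N\<^sup>T *\<^sub>v x) \<bullet> q - x \<bullet> q"
    unfolding d_def using NT x q by (intro minus_scalar_prod_distrib[of _ k]) auto
  also have "(N\<^sup>T *\<^sub>v x) \<bullet> q = x \<bullet> (N *\<^sub>v q)" by (rule transpose_vec_mult_scalar[OF N q(1) x])
  also have "\<dots> - x \<bullet> q \<le> 0" using scalar_prod_mono[OF x0 Nq q(1)] by simp
  finally have "(\<Sum>i<k. d $ i * q $ i) \<le> 0"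
    using q by (simp add: scalar_prod_def atLeast0LessThan)
  moreover have nn: "0 \<le> d $ i * q $ i" if "i < k" for i
    using d0[OF that] q(2)[OF that] by simp
  ultimately have "(\<Sum>i<k. d $ i * q $ i) = 0" by (intro antisym sum_nonneg) auto
  then have "\<forall>i<k. d $ i * q $ i = 0" using nn by (subst (asm) sum_nonneg_eq_0_iff) auto
  then have "d $ i = 0" if "i < k" for i using that q(2)[OF that] by force
  then have "N\<^sup>T *\<^sub>v x = x"
    using x N by (intro eq_vecI) (simp_all add: d_def del: index_mult_mat_vec)
  moreover have "x \<noteq> 0\<^sub>v k"
  proof
    assume "x = 0\<^sub>v k"
    then have "cmod (y $ i) = 0" if "i < k" for i
      using that by (simp add: x_def vec_eq_iff)
    with y(1) have "y = 0\<^sub>v k" by (intro eq_vecI) auto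
    with y(2) show False by simp
  qed
  ultimately show ?thesis using x0 that by blast
qed

section \<open>Removing a simple zero eigenvalue\<close>

definition outer_prod :: "'a :: times vec \<Rightarrow> 'a vec \<Rightarrow> 'a mat" where
  "outer_prod u v = mat (dim_vec u) (dim_vec v) (\<lambda>(i, j). u $ i * v $ j)"

lemma outer_prod_carrier: "u \<in> carrier_vec nr \<Longrightarrow> v \<in> carrier_vec nc \<Longrightarrow> outer_prod u v \<in> carrier_mat nr nc"
  by (auto simp: outer_prod_def)

lemma outer_prod_mult_vec:
  fixes u :: "'a :: comm_semiring_0 vec"
  assumes "v \<in> carrier_vec n" "f \<in> carrier_vec n"
  shows "outer_prod u v *\<^sub>v f = (v \<bullet> f) \<cdot>\<^sub>v u"
  using assms
  by (intro eq_vecI) (auto simp: outer_prod_def scalar_prod_def sum_distrib_right sum_distrib_left ac_simps intro!: sum.cong)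

lemma transpose_outer_prod: "(outer_prod u v)\<^sup>T = outer_prod v (u :: 'a :: comm_semiring_0 vec)"
  by (auto simp: outer_prod_def ac_simps)

text \<open>If (M + v u) z = 0, multiplying by u from the left gives (u z)(u v) = 0, since u M = 0. So u z = 0 and
  M z = 0, hence z is a multiple of v, and u v \<noteq> 0 forces the multiple to be 0.\<close>
lemma simple_kernel_rank_one_update_det:
  fixes M :: "'a :: field mat"
  assumes M: "M \<in> carrier_mat n n" and k1: "kernel_dim M = 1"
    and v: "v \<in> carrier_vec n" "v \<noteq> 0\<^sub>v n" "M *\<^sub>v v = 0\<^sub>v n"
    and u: "u \<in> carrier_vec n" "M\<^sup>T *\<^sub>v u = 0\<^sub>v n" and uv: "u \<bullet> v \<noteq> 0"
  shows "det (M + outer_prod v u) \<noteq> 0"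
proof
  note P = outer_prod_carrier[OF v(1) u(1)]
  assume "det (M + outer_prod v u) = 0"
  then obtain z where z: "z \<in> carrier_vec n" "z \<noteq> 0\<^sub>v n" "(M + outer_prod v u) *\<^sub>v z = 0\<^sub>v n"
    using det_0_iff_vec_prod_zero_field[of "M + outer_prod v u" n] M P by auto
  have eq: "M *\<^sub>v z + (u \<bullet> z) \<cdot>\<^sub>v v = 0\<^sub>v n"
    using z(3) add_mult_distrib_mat_vec[OF M P z(1)] outer_prod_mult_vec[OF u(1) z(1)] by simp
  have "u \<bullet> (M *\<^sub>v z) = (M\<^sup>T *\<^sub>v u) \<bullet> z" by (rule transpose_vec_mult_scalar[OF M z(1) u(1), symmetric])
  then have "u \<bullet> (M *\<^sub>v z) = 0" using u z by simp
  moreover have "u \<bullet> (M *\<^sub>v z + (u \<bullet> z) \<cdot>\<^sub>v v) = u \<bullet> (M *\<^sub>v z) + (u \<bullet> z) * (u \<bullet> v)"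
    using M z u v by (subst scalar_prod_add_distrib[of _ n]) auto
  ultimately have "(u \<bullet> z) * (u \<bullet> v) = 0" using eq u by simp
  then have uz: "u \<bullet> z = 0" using uv by simp
  have "(0::'a) \<cdot>\<^sub>v v = 0\<^sub>v n" using v by auto
  then have "M *\<^sub>v z = 0\<^sub>v n" using eq uz M z by simp
  then obtain c where c: "z = c \<cdot>\<^sub>v v" using kernel_dim_1_multiple[OF M k1 v z(1)] by blast
  then have "c * (u \<bullet> v) = 0" using uz u v by simp
  then have "c = 0" using uv by simp
  then show False using c z v by auto
qed

text \<open>The map J embeds vectors of length k into a subspace invariant under G, on which G acts as \<sigma> T.
  On the vectors orthogonal to v, where G and L agree, a shifted system for L therefore reduces to one
  for e + T. The solution stays orthogonal to v: the range of G is orthogonal to v, so v is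
  orthogonal to J w as soon as it is orthogonal to the shifted image of J w. For the same
  reason a null vector of e + T would give one of the shifted L; this makes e + T nonsingular, and the
  conditional hypothesis on its monotonicity applies.\<close>
lemma resolvent_on_invariant_graph:
  fixes L G T :: "real mat" and J :: "real vec \<Rightarrow> real vec"
  assumes L: "L \<in> carrier_mat N N" and G: "G \<in> carrier_mat N N" and T: "T \<in> carrier_mat k k"
    and v: "v \<in> carrier_vec N"
    and vG: "\<And>f. f \<in> carrier_vec N \<Longrightarrow> v \<bullet> (G *\<^sub>v f) = 0"
    and LG: "\<And>f. f \<in> carrier_vec N \<Longrightarrow> v \<bullet> f = 0 \<Longrightarrow> L *\<^sub>v f = G *\<^sub>v f"
    and J: "\<And>w. w \<in> carrier_vec k \<Longrightarrow> J w \<in> carrier_vec N"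
    and J_lin: "\<And>w z. w \<in> carrier_vec k \<Longrightarrow> z \<in> carrier_vec k \<Longrightarrow> J (e \<cdot>\<^sub>v w + z) = e \<cdot>\<^sub>v J w + J z"
    and J_0: "\<And>w. w \<in> carrier_vec k \<Longrightarrow> J w = 0\<^sub>v N \<longleftrightarrow> w = 0\<^sub>v k"
    and GJ: "\<And>w. w \<in> carrier_vec k \<Longrightarrow> G *\<^sub>v J w = \<sigma> \<cdot>\<^sub>v J (T *\<^sub>v w)" and \<sigma>: "\<sigma> \<noteq> 0"
    and e: "e \<noteq> 0" and det: "det ((\<sigma> * e) \<cdot>\<^sub>m 1\<^sub>m N + L) \<noteq> 0"
    and mono: "det (e \<cdot>\<^sub>m 1\<^sub>m k + T) \<noteq> 0 \<Longrightarrow> monotone_mat k (e \<cdot>\<^sub>m 1\<^sub>m k + T)"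
    and x: "0\<^sub>v k \<le> x" and vx: "v \<bullet> J x = 0"
  obtains w where "0\<^sub>v k \<le> w" "((\<sigma> * e) \<cdot>\<^sub>m 1\<^sub>m N + L) *\<^sub>v J w = \<sigma> \<cdot>\<^sub>v J x"
proof -
  let ?T = "e \<cdot>\<^sub>m 1\<^sub>m k + T" and ?L = "(\<sigma> * e) \<cdot>\<^sub>m 1\<^sub>m N + L"
  have Tc: "?T \<in> carrier_mat k k" and Lc: "?L \<in> carrier_mat N N" using T L by auto
  have key: "?L *\<^sub>v J w = \<sigma> \<cdot>\<^sub>v J (?T *\<^sub>v w)" 
    if w: "w \<in> carrier_vec k" and v0: "v \<bullet> J (?T *\<^sub>v w) = 0" for w
  proof -
    have Tw: "T *\<^sub>v w \<in> carrier_vec k" using T w by auto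
    have "?T *\<^sub>v w = e \<cdot>\<^sub>v w + T *\<^sub>v w"
      using T w by (subst add_mult_distrib_mat_vec[of _ k k]) (auto simp: smult_mat_mult_vec[of _ k k])
    then have JT: "J (?T *\<^sub>v w) = e \<cdot>\<^sub>v J w + J (T *\<^sub>v w)" using J_lin[OF w Tw] by simp
    have "v \<bullet> (\<sigma> \<cdot>\<^sub>v J (T *\<^sub>v w)) = 0" using vG[OF J[OF w]] GJ[OF w] by simp
    then have "v \<bullet> J (T *\<^sub>v w) = 0" using \<sigma> v J[OF Tw] by simp
    then have "e * (v \<bullet> J w) = 0"
      using v0 JT J[OF w] J[OF Tw] v by (simp add: scalar_prod_add_distrib[of _ N])
    then have "L *\<^sub>v J w = \<sigma> \<cdot>\<^sub>v J (T *\<^sub>v w)"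
      using e LG[OF J[OF w]] GJ[OF w] by simp
    then have "?L *\<^sub>v J w = (\<sigma> * e) \<cdot>\<^sub>v J w + \<sigma> \<cdot>\<^sub>v J (T *\<^sub>v w)"
      using L J[OF w] by (subst add_mult_distrib_mat_vec[of _ N N]) (auto simp: smult_mat_mult_vec[of _ N N])
    also have "\<dots> = \<sigma> \<cdot>\<^sub>v J (?T *\<^sub>v w)"
      unfolding JT using J[OF w] J[OF Tw] by (intro eq_vecI) (auto simp: algebra_simps)
    finally show ?thesis .
  qed
  have "det ?T \<noteq> 0"
  proof
    assume "det ?T = 0"
    then obtain z where z: "z \<in> carrier_vec k" "z \<noteq> 0\<^sub>v k" "?T *\<^sub>v z = 0\<^sub>v k"
      using det_0_iff_vec_prod_zero_field[OF Tc] by auto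
    have J0: "J (0\<^sub>v k) = 0\<^sub>v N" using J_0[of "0\<^sub>v k"] by simp
    have "?L *\<^sub>v J z = \<sigma> \<cdot>\<^sub>v J (0\<^sub>v k)" using key[OF z(1)] z(3) J0 v by simp
    moreover have "\<sigma> \<cdot>\<^sub>v J (0\<^sub>v k) = 0\<^sub>v N" unfolding J0 by auto
    ultimately have "?L *\<^sub>v J z = 0\<^sub>v N" by simp
    moreover have "J z \<noteq> 0\<^sub>v N" using J_0 z by simp
    ultimately show False using det det_0_iff_vec_prod_zero_field[OF Lc] J[OF z(1)] by blast
  qed
  then have M: "monotone_mat k ?T" by (rule mono)
  have xc: "x \<in> carrier_vec k" using x by (simp add: zero_le_vec_iff)
  obtain w where w: "w \<in> carrier_vec k" "?T *\<^sub>v w = x"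
    using det_nonzero_solve[OF Tc \<open>det ?T \<noteq> 0\<close> xc] by blast
  then have "0\<^sub>v k \<le> w" using M x by (simp add: monotone_mat_def)
  moreover have "?L *\<^sub>v J w = \<sigma> \<cdot>\<^sub>v J x" using key[OF w(1)] w(2) vx by simp
  ultimately show ?thesis by (rule that)
qed

section \<open>The invariant subspaces given by the two solutions\<close>

context riccati begin

text \<open>The transpose of the matrix H of the Riccati equation.\<close>
definition hamiltonian_transpose :: "real mat" where
  "hamiltonian_transpose = four_block_mat D\<^sup>T B\<^sup>T (- C\<^sup>T) (- A\<^sup>T)"

lemma blocks_carrier: "D\<^sup>T \<in> carrier_mat n n" "B\<^sup>T \<in> carrier_mat n m" "- C\<^sup>T \<in> carrier_mat m n" "- A\<^sup>T \<in> carrier_mat m m"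
  "C\<^sup>T \<in> carrier_mat m n" "A\<^sup>T \<in> carrier_mat m m"
  using A B C D by auto

lemma hamiltonian_transpose_carrier: "hamiltonian_transpose \<in> carrier_mat (n + m) (n + m)"
  using blocks_carrier by (simp add: hamiltonian_transpose_def)

lemma hamiltonian_transpose_mult_vec:
  assumes f: "f1 \<in> carrier_vec n" "f2 \<in> carrier_vec m"
  shows "hamiltonian_transpose *\<^sub>v (f1 @\<^sub>v f2)
    = (D\<^sup>T *\<^sub>v f1 + B\<^sup>T *\<^sub>v f2) @\<^sub>v (- (C\<^sup>T *\<^sub>v f1) - A\<^sup>T *\<^sub>v f2)"
proof -
  have "- C\<^sup>T *\<^sub>v f1 = - (C\<^sup>T *\<^sub>v f1)" "- A\<^sup>T *\<^sub>v f2 = - (A\<^sup>T *\<^sub>v f2)"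
    using blocks_carrier f by (auto simp: uminus_mult_mat_vec)
  moreover have "a + - b = a - b" if "a \<in> carrier_vec m" "b \<in> carrier_vec m" for a b :: "real vec"
    using that by (intro eq_vecI) auto
  ultimately show ?thesis
    unfolding hamiltonian_transpose_def four_block_mat_mult_vec[OF blocks_carrier(1-4) f] using blocks_carrier f by simp
qed

lemma transpose_residual:
  assumes X: "X \<in> carrier_mat m n"
  shows "(residual X)\<^sup>T = X\<^sup>T * C\<^sup>T * X\<^sup>T - X\<^sup>T * A\<^sup>T - D\<^sup>T * X\<^sup>T + B\<^sup>T"
proof -
  have c: "X * C * X \<in> carrier_mat m n" "X * D \<in> carrier_mat m n" "A * X \<in> carrier_mat m n"
    "X * C \<in> carrier_mat m m" "C * X \<in> carrier_mat n n"
    using X A C D by auto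
  have "(P - Q - R + B)\<^sup>T = P\<^sup>T - R\<^sup>T - Q\<^sup>T + B\<^sup>T"
    if "P \<in> carrier_mat m n" "Q \<in> carrier_mat m n" "R \<in> carrier_mat m n" for P Q R
    using that B by (intro eq_matI) auto
  from this[OF c(1-3)] have "(residual X)\<^sup>T = (X * C * X)\<^sup>T - (A * X)\<^sup>T - (X * D)\<^sup>T + B\<^sup>T" .
  moreover have "(X * C * X)\<^sup>T = X\<^sup>T * C\<^sup>T * X\<^sup>T"
    using transpose_mult[OF c(4) X] transpose_mult[OF X C] X C
    by (simp add: assoc_mult_mat[of _ n m _ n _ m])
  ultimately show ?thesis by (simp add: transpose_mult[OF A X] transpose_mult[OF X D])
qed

lemma transpose_riccati: "riccati n m D\<^sup>T B\<^sup>T C\<^sup>T A\<^sup>T"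
  using A D B0 C0 A_off D_off by unfold_locales (auto simp: zero_le_mat_iff)

lemma loop_transpose_mult_vec:
  assumes X: "X \<in> carrier_mat m n" and w: "w \<in> carrier_vec m"
  shows "(A - X * C)\<^sup>T *\<^sub>v w = A\<^sup>T *\<^sub>v w - C\<^sup>T *\<^sub>v (X\<^sup>T *\<^sub>v w)"
proof -
  have XC: "X * C \<in> carrier_mat m m" using X C by auto
  have "(A - X * C)\<^sup>T = A\<^sup>T - C\<^sup>T * X\<^sup>T"
    using transpose_minus[OF A XC] transpose_mult[OF X C] by simp
  moreover have "(A\<^sup>T - C\<^sup>T * X\<^sup>T) *\<^sub>v w = A\<^sup>T *\<^sub>v w - (C\<^sup>T * X\<^sup>T) *\<^sub>v w"
    using A C X w by (intro minus_mult_distrib_mat_vec[of _ m m]) auto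
  moreover have "(C\<^sup>T * X\<^sup>T) *\<^sub>v w = C\<^sup>T *\<^sub>v (X\<^sup>T *\<^sub>v w)"
    using C X w by (intro assoc_mult_mat_vec[of _ m n]) auto
  ultimately show ?thesis by simp
qed

text \<open>For the row vector w this is the Riccati equation w (A - X C) X = w (B - X D), which expresses that the
  row space of [-X, I] is invariant under H.\<close>
lemma solution_transpose_loop:
  assumes X: "X \<in> carrier_mat m n" and sol: "residual X = 0\<^sub>m m n" and w: "w \<in> carrier_vec m"
  shows "X\<^sup>T *\<^sub>v ((A - X * C)\<^sup>T *\<^sub>v w) = B\<^sup>T *\<^sub>v w - D\<^sup>T *\<^sub>v (X\<^sup>T *\<^sub>v w)"
proof -
  interpret tr: riccati n m "D\<^sup>T" "B\<^sup>T" "C\<^sup>T" "A\<^sup>T" by (rule transpose_riccati)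
  have XT: "X\<^sup>T \<in> carrier_mat n m" and Xw: "X\<^sup>T *\<^sub>v w \<in> carrier_vec n" using X w by auto
  have z: "0\<^sub>v n = X\<^sup>T *\<^sub>v (C\<^sup>T *\<^sub>v (X\<^sup>T *\<^sub>v w)) - X\<^sup>T *\<^sub>v (A\<^sup>T *\<^sub>v w) - D\<^sup>T *\<^sub>v (X\<^sup>T *\<^sub>v w) + B\<^sup>T *\<^sub>v w"
  proof -
    have "0\<^sub>v n = (0\<^sub>m m n)\<^sup>T *\<^sub>v w" using w by auto
    then show ?thesis
      using tr.residual_mult_vec[OF XT w] unfolding transpose_residual[OF X, symmetric] sol by simp
  qed
  have "a - b = c - d" if "0\<^sub>v n = b - a - d + c" "a \<in> carrier_vec n" "b \<in> carrier_vec n"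
    "c \<in> carrier_vec n" "d \<in> carrier_vec n" for a b c d :: "real vec"
  proof (rule eq_vecI)
    fix i assume "i < dim_vec (c - d)"
    then show "(a - b) $ i = (c - d) $ i"
      using arg_cong[OF that(1), of "\<lambda>u. u $ i"] that(2-5) by simp
  qed (use that(2-5) in simp)
  note rearrange = this[OF z]
  have "X\<^sup>T *\<^sub>v ((A - X * C)\<^sup>T *\<^sub>v w) = X\<^sup>T *\<^sub>v (A\<^sup>T *\<^sub>v w) - X\<^sup>T *\<^sub>v (C\<^sup>T *\<^sub>v (X\<^sup>T *\<^sub>v w))"
    unfolding loop_transpose_mult_vec[OF X w]
    using A C Xw w by (intro mult_minus_distrib_mat_vec[OF XT]) auto
  also have "\<dots> = B\<^sup>T *\<^sub>v w - D\<^sup>T *\<^sub>v (X\<^sup>T *\<^sub>v w)"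
    using w A B C D XT Xw by (intro rearrange) auto
  finally show ?thesis .
qed

end

text \<open>The setting of the main argument: q is positive with K q \<ge> 0, v is a nonnegative null
  vector, and L stands for the transpose of H + v u, of which only invertibility and the agreement
  with H on vectors orthogonal to v matter.\<close>
locale riccati_solutions = riccati m n A B C D for m n A B C D +
  fixes \<Phi> \<Psi> L :: "real mat" and q1 q2 v1 v2 :: "real vec"
  assumes \<Phi>: "minimal_nonneg_solution m n residual \<Phi>"
    and \<Psi>: "minimal_nonneg_solution n m (\<lambda>Y. Y * B * Y - Y * A - D * Y + C) \<Psi>"
    and q1: "q1 \<in> carrier_vec n" "\<And>i. i < n \<Longrightarrow> 0 < q1 $ i"
    and q2: "q2 \<in> carrier_vec m" "\<And>i. i < m \<Longrightarrow> 0 < q2 $ i"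
    and K1: "C *\<^sub>v q2 \<le> D *\<^sub>v q1" and K2: "B *\<^sub>v q1 \<le> A *\<^sub>v q2"
    and v0: "0\<^sub>v n \<le> v1" "0\<^sub>v m \<le> v2"
    and Kv: "D *\<^sub>v v1 = C *\<^sub>v v2" "A *\<^sub>v v2 = B *\<^sub>v v1"
    and L: "L \<in> carrier_mat (n + m) (n + m)" "det L \<noteq> 0"
    and LG: "\<And>f. f \<in> carrier_vec (n + m) \<Longrightarrow> (v1 @\<^sub>v v2) \<bullet> f = 0 \<Longrightarrow> L *\<^sub>v f = hamiltonian_transpose *\<^sub>v f"
begin

sublocale dual: riccati n m D C B A
  using A D B0 C0 A_off D_off by unfold_locales auto

lemma \<Phi>_solution: "\<Phi> \<in> carrier_mat m n" "0\<^sub>m m n \<le> \<Phi>" "residual \<Phi> = 0\<^sub>m m n"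
  and \<Psi>_solution: "\<Psi> \<in> carrier_mat n m" "0\<^sub>m n m \<le> \<Psi>" "dual.residual \<Psi> = 0\<^sub>m n m"
  using \<Phi> \<Psi> by (auto simp: minimal_nonneg_solution_def)

lemma solutions_carrier: "\<Phi>\<^sup>T \<in> carrier_mat n m" "\<Psi>\<^sup>T \<in> carrier_mat m n"
  using \<Phi>_solution \<Psi>_solution by auto

lemma v_carrier: "v1 \<in> carrier_vec n" "v2 \<in> carrier_vec m"
  using v0 by (simp_all add: zero_le_vec_iff)

lemma q_nonneg: "0\<^sub>v n \<le> q1" "0\<^sub>v m \<le> q2"
  using q1 q2 by (simp_all add: zero_le_vec_iff less_imp_le)

text \<open>The vector v is a right null vector of H.\<close>
lemma hamiltonian_transpose_orthogonal:
  assumes f: "f \<in> carrier_vec (n + m)"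
  shows "(v1 @\<^sub>v v2) \<bullet> (hamiltonian_transpose *\<^sub>v f) = 0"
proof -
  obtain f1 f2 where f12: "f = f1 @\<^sub>v f2" "f1 \<in> carrier_vec n" "f2 \<in> carrier_vec m"
    using vec_first_last_append[OF f] by (metis vec_first_carrier vec_last_carrier)
  have c: "D\<^sup>T *\<^sub>v f1 \<in> carrier_vec n" "B\<^sup>T *\<^sub>v f2 \<in> carrier_vec n"
    "C\<^sup>T *\<^sub>v f1 \<in> carrier_vec m" "A\<^sup>T *\<^sub>v f2 \<in> carrier_vec m" using blocks_carrier f12 by auto
  have "(v1 @\<^sub>v v2) \<bullet> (hamiltonian_transpose *\<^sub>v f) = v1 \<bullet> (D\<^sup>T *\<^sub>v f1) + v1 \<bullet> (B\<^sup>T *\<^sub>v f2) - v2 \<bullet> (C\<^sup>T *\<^sub>v f1) - v2 \<bullet> (A\<^sup>T *\<^sub>v f2)"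
    unfolding f12(1) hamiltonian_transpose_mult_vec[OF f12(2,3)] using v_carrier c carrier_matD[OF C]
    by (simp add: scalar_prod_append[of _ n _ m] scalar_prod_add_distrib[of _ n] scalar_prod_minus_distrib[of _ m])
  moreover have "v1 \<bullet> (D\<^sup>T *\<^sub>v f1) = (D *\<^sub>v v1) \<bullet> f1" "v1 \<bullet> (B\<^sup>T *\<^sub>v f2) = (B *\<^sub>v v1) \<bullet> f2"
    "v2 \<bullet> (C\<^sup>T *\<^sub>v f1) = (C *\<^sub>v v2) \<bullet> f1" "v2 \<bullet> (A\<^sup>T *\<^sub>v f2) = (A *\<^sub>v v2) \<bullet> f2"
    using transpose_vec_mult_scalar[OF blocks_carrier(1) f12(2) v_carrier(1)] transpose_vec_mult_scalar[OF blocks_carrier(2) f12(3) v_carrier(1)]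
      transpose_vec_mult_scalar[OF blocks_carrier(5) f12(2) v_carrier(2)] transpose_vec_mult_scalar[OF blocks_carrier(6) f12(3) v_carrier(2)]
    by simp_all
  ultimately show ?thesis using Kv by simp
qed

text \<open>Transposes of the row vectors w [-\<Phi>, I] and w [I, -\<Psi>].\<close>
definition primal_graph :: "real vec \<Rightarrow> real vec" where
  "primal_graph w = (- (\<Phi>\<^sup>T *\<^sub>v w)) @\<^sub>v w"

definition dual_graph :: "real vec \<Rightarrow> real vec" where
  "dual_graph w = w @\<^sub>v (- (\<Psi>\<^sup>T *\<^sub>v w))"

lemma primal_graph_carrier: "w \<in> carrier_vec m \<Longrightarrow> primal_graph w \<in> carrier_vec (n + m)"
  and dual_graph_carrier: "w \<in> carrier_vec n \<Longrightarrow> dual_graph w \<in> carrier_vec (n + m)"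
  using solutions_carrier by (auto simp: primal_graph_def dual_graph_def)

text \<open>H acts on the rows w [-\<Phi>, I] as -(A - \<Phi> C), so that subtracting e from H corresponds to adding e to
  A - \<Phi> C.\<close>
lemma primal_graph_resolvent:
  assumes e: "0 < e" and det: "det ((- 1 * e) \<cdot>\<^sub>m 1\<^sub>m (n + m) + L) \<noteq> 0"
    and x0: "0\<^sub>v m \<le> x" and vx: "(v1 @\<^sub>v v2) \<bullet> primal_graph x = 0"
  obtains w where "0\<^sub>v m \<le> w"
    "((- 1 * e) \<cdot>\<^sub>m 1\<^sub>m (n + m) + L) *\<^sub>v primal_graph w = - primal_graph x"
proof -
  have tr: "e \<cdot>\<^sub>m 1\<^sub>m m + (A - \<Phi> * C)\<^sup>T = (shifted_loop e \<Phi>)\<^sup>T"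
    using A C \<Phi>_solution by (intro eq_matI) (auto simp: shifted_loop_def simp del: index_mult_mat(1))
  have loopT: "(A - \<Phi> * C)\<^sup>T \<in> carrier_mat m m" using \<Phi>_solution C A by auto
  show ?thesis
  proof (rule resolvent_on_invariant_graph[OF L(1) hamiltonian_transpose_carrier loopT _
        hamiltonian_transpose_orthogonal LG, of primal_graph e "- 1" x])
    show "(v1 @\<^sub>v v2) \<in> carrier_vec (n + m)" using v_carrier by simp
    show "primal_graph (e \<cdot>\<^sub>v w + z) = e \<cdot>\<^sub>v primal_graph w + primal_graph z" if "w \<in> carrier_vec m" "z \<in> carrier_vec m" for w z
    proof -
      have "\<Phi>\<^sup>T *\<^sub>v (e \<cdot>\<^sub>v w + z) = e \<cdot>\<^sub>v (\<Phi>\<^sup>T *\<^sub>v w) + \<Phi>\<^sup>T *\<^sub>v z"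
        using blocks_carrier solutions_carrier that by (simp add: mult_add_distrib_mat_vec[of _ n m] mult_mat_vec[of _ n m])
      then show ?thesis
        using blocks_carrier solutions_carrier that by (intro eq_vecI) (auto simp: primal_graph_def simp del: index_mult_mat_vec)
    qed
    show "primal_graph w = 0\<^sub>v (n + m) \<longleftrightarrow> w = 0\<^sub>v m" if w: "w \<in> carrier_vec m" for w
    proof
      assume eq: "primal_graph w = 0\<^sub>v (n + m)"
      have "w $ i = 0" if "i < m" for i
        using arg_cong[OF eq, of "\<lambda>u. u $ (n + i)"] that w blocks_carrier solutions_carrier by (simp add: primal_graph_def)
      then show "w = 0\<^sub>v m" using w by auto
    next
      assume "w = 0\<^sub>v m"
      then show "primal_graph w = 0\<^sub>v (n + m)" using blocks_carrier solutions_carrier by (intro eq_vecI) (auto simp: primal_graph_def)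
    qed
    show "hamiltonian_transpose *\<^sub>v primal_graph w = - 1 \<cdot>\<^sub>v primal_graph ((A - \<Phi> * C)\<^sup>T *\<^sub>v w)" if w: "w \<in> carrier_vec m" for w
    proof -
      have c: "- (\<Phi>\<^sup>T *\<^sub>v w) \<in> carrier_vec n" using blocks_carrier solutions_carrier w by auto
      have neg: "D\<^sup>T *\<^sub>v (- (\<Phi>\<^sup>T *\<^sub>v w)) = - (D\<^sup>T *\<^sub>v (\<Phi>\<^sup>T *\<^sub>v w))" "C\<^sup>T *\<^sub>v (- (\<Phi>\<^sup>T *\<^sub>v w)) = - (C\<^sup>T *\<^sub>v (\<Phi>\<^sup>T *\<^sub>v w))"
        using blocks_carrier solutions_carrier w by (intro eq_vecI; auto)+
      show ?thesis
        unfolding primal_graph_def hamiltonian_transpose_mult_vec[OF c w] solution_transpose_loop[OF \<Phi>_solution(1,3) w] neg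
        unfolding loop_transpose_mult_vec[OF \<Phi>_solution(1) w]
        using blocks_carrier solutions_carrier w by (intro eq_vecI) (auto simp del: index_mult_mat_vec)
    qed
    show "monotone_mat m (e \<cdot>\<^sub>m 1\<^sub>m m + (A - \<Phi> * C)\<^sup>T)"
      if "det (e \<cdot>\<^sub>m 1\<^sub>m m + (A - \<Phi> * C)\<^sup>T) \<noteq> 0"
    proof -
      have "det (shifted_loop e \<Phi>) \<noteq> 0"
        using that unfolding tr det_transpose[OF shifted_loop_carrier[OF \<Phi>_solution(1)]] .
      from minimal_solution_shifted_loop_monotone_mat[OF \<Phi> e this q_nonneg(1) q2 K1 K2]
      show ?thesis unfolding tr by (rule monotone_mat_transpose)
    qed
    fix w assume "0\<^sub>v m \<le> w"
      "((- 1 * e) \<cdot>\<^sub>m 1\<^sub>m (n + m) + L) *\<^sub>v primal_graph w = - 1 \<cdot>\<^sub>v primal_graph x"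
    moreover have "- 1 \<cdot>\<^sub>v primal_graph x = - primal_graph x" by auto
    ultimately show ?thesis using that by metis
  qed (use primal_graph_carrier e det x0 vx in auto)
qed

text \<open>Here H acts on the rows w [I, -\<Psi>] as D - \<Psi> B, without the minus sign, and the shift of H is +e.\<close>
lemma dual_graph_resolvent:
  assumes e: "0 < e" and det: "det ((1 * e) \<cdot>\<^sub>m 1\<^sub>m (n + m) + L) \<noteq> 0"
    and y0: "0\<^sub>v n \<le> y" and vy: "(v1 @\<^sub>v v2) \<bullet> dual_graph y = 0"
  obtains w where "0\<^sub>v n \<le> w"
    "((1 * e) \<cdot>\<^sub>m 1\<^sub>m (n + m) + L) *\<^sub>v dual_graph w = dual_graph y"
proof -
  have tr: "e \<cdot>\<^sub>m 1\<^sub>m n + (D - \<Psi> * B)\<^sup>T = (dual.shifted_loop e \<Psi>)\<^sup>T"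
    using D B \<Psi>_solution by (intro eq_matI) (auto simp: dual.shifted_loop_def simp del: index_mult_mat(1))
  have loopT: "(D - \<Psi> * B)\<^sup>T \<in> carrier_mat n n" using \<Psi>_solution B D by auto
  show ?thesis
  proof (rule resolvent_on_invariant_graph[OF L(1) hamiltonian_transpose_carrier loopT _
        hamiltonian_transpose_orthogonal LG, of dual_graph e 1 y])
    show "(v1 @\<^sub>v v2) \<in> carrier_vec (n + m)" using v_carrier by simp
    show "dual_graph (e \<cdot>\<^sub>v w + z) = e \<cdot>\<^sub>v dual_graph w + dual_graph z" if "w \<in> carrier_vec n" "z \<in> carrier_vec n" for w z
    proof -
      have "\<Psi>\<^sup>T *\<^sub>v (e \<cdot>\<^sub>v w + z) = e \<cdot>\<^sub>v (\<Psi>\<^sup>T *\<^sub>v w) + \<Psi>\<^sup>T *\<^sub>v z"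
        using blocks_carrier solutions_carrier that by (simp add: mult_add_distrib_mat_vec[of _ m n] mult_mat_vec[of _ m n])
      then show ?thesis
        using blocks_carrier solutions_carrier that by (intro eq_vecI) (auto simp: dual_graph_def simp del: index_mult_mat_vec)
    qed
    show "dual_graph w = 0\<^sub>v (n + m) \<longleftrightarrow> w = 0\<^sub>v n" if w: "w \<in> carrier_vec n" for w
    proof
      assume eq: "dual_graph w = 0\<^sub>v (n + m)"
      have "w $ i = 0" if "i < n" for i
        using arg_cong[OF eq, of "\<lambda>u. u $ i"] that w blocks_carrier solutions_carrier by (simp add: dual_graph_def)
      then show "w = 0\<^sub>v n" using w by auto
    next
      assume "w = 0\<^sub>v n"
      then show "dual_graph w = 0\<^sub>v (n + m)" using blocks_carrier solutions_carrier by (intro eq_vecI) (auto simp: dual_graph_def)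
    qed
    show "hamiltonian_transpose *\<^sub>v dual_graph w = 1 \<cdot>\<^sub>v dual_graph ((D - \<Psi> * B)\<^sup>T *\<^sub>v w)" if w: "w \<in> carrier_vec n" for w
    proof -
      have c: "- (\<Psi>\<^sup>T *\<^sub>v w) \<in> carrier_vec m" using blocks_carrier solutions_carrier w by auto
      have neg: "B\<^sup>T *\<^sub>v (- (\<Psi>\<^sup>T *\<^sub>v w)) = - (B\<^sup>T *\<^sub>v (\<Psi>\<^sup>T *\<^sub>v w))" "A\<^sup>T *\<^sub>v (- (\<Psi>\<^sup>T *\<^sub>v w)) = - (A\<^sup>T *\<^sub>v (\<Psi>\<^sup>T *\<^sub>v w))"
        using blocks_carrier solutions_carrier w by (intro eq_vecI; auto)+
      show ?thesis
        unfolding dual_graph_def hamiltonian_transpose_mult_vec[OF w c] dual.solution_transpose_loop[OF \<Psi>_solution(1,3) w] neg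
        unfolding dual.loop_transpose_mult_vec[OF \<Psi>_solution(1) w]
        using blocks_carrier solutions_carrier w by (intro eq_vecI) (auto simp del: index_mult_mat_vec)
    qed
    show "monotone_mat n (e \<cdot>\<^sub>m 1\<^sub>m n + (D - \<Psi> * B)\<^sup>T)"
      if "det (e \<cdot>\<^sub>m 1\<^sub>m n + (D - \<Psi> * B)\<^sup>T) \<noteq> 0"
    proof -
      have "det (dual.shifted_loop e \<Psi>) \<noteq> 0"
        using that unfolding tr det_transpose[OF dual.shifted_loop_carrier[OF \<Psi>_solution(1)]] .
      from dual.minimal_solution_shifted_loop_monotone_mat[OF \<Psi> e this q_nonneg(2) q1 K2 K1]
      show ?thesis unfolding tr by (rule monotone_mat_transpose)
    qed
    fix w assume "0\<^sub>v n \<le> w"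
      "((1 * e) \<cdot>\<^sub>m 1\<^sub>m (n + m) + L) *\<^sub>v dual_graph w = 1 \<cdot>\<^sub>v dual_graph y"
    then show ?thesis using that by simp
  qed (use dual_graph_carrier e det y0 vy in auto)
qed

text \<open>The contradiction at the heart of the proof: g lies in both invariant subspaces and is orthogonal to v,
  so the solution h of L h = -g is approximated from both subspaces, by vectors with opposite sign
  patterns.\<close>
lemma nonneg_left_fixed_vector_eq_zero:
  assumes x0: "0\<^sub>v m \<le> x" and fixed: "\<Psi>\<^sup>T *\<^sub>v (\<Phi>\<^sup>T *\<^sub>v x) = x"
  shows "x = 0\<^sub>v m"
proof -
  define y where "y = \<Phi>\<^sup>T *\<^sub>v x"
  have xc: "x \<in> carrier_vec m" using x0 by (simp add: zero_le_vec_iff)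
  have y0: "0\<^sub>v n \<le> y"
    unfolding y_def using \<Phi>_solution x0 by (intro zero_le_mult_mat_vec[where k = m]) (auto simp: zero_le_mat_iff)
  have yc: "y \<in> carrier_vec n" using y0 by (simp add: zero_le_vec_iff)
  have \<Psi>y: "\<Psi>\<^sup>T *\<^sub>v y = x" using fixed by (simp add: y_def)
  define g where "g = primal_graph x"
  \<comment> \<open>both descriptions of the common vector of the two subspaces\<close>
  have dual_y: "dual_graph y = - g"
    using solutions_carrier xc yc
    by (intro eq_vecI) (auto simp: primal_graph_def dual_graph_def g_def \<Psi>y y_def[symmetric] simp del: index_mult_mat_vec)
  \<comment> \<open>the two inequalities bound the pairing of v and g from both sides by 0\<close>
  have "x \<bullet> (\<Phi> *\<^sub>v v1) \<le> x \<bullet> v2"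
    using minimal_solution_mult_vec_le[OF \<Phi> v_carrier(1) v0(2)] Kv
    by (intro scalar_prod_mono[OF x0 _ v_carrier(2)]) auto
  then have ge: "y \<bullet> v1 \<le> x \<bullet> v2"
    using transpose_vec_mult_scalar[OF \<Phi>_solution(1) v_carrier(1) xc] by (simp add: y_def)
  have "y \<bullet> (\<Psi> *\<^sub>v v2) \<le> y \<bullet> v1"
    using dual.minimal_solution_mult_vec_le[OF \<Psi> v_carrier(2) v0(1)] Kv
    by (intro scalar_prod_mono[OF y0 _ v_carrier(1)]) auto
  then have "x \<bullet> v2 \<le> y \<bullet> v1"
    using transpose_vec_mult_scalar[OF \<Psi>_solution(1) v_carrier(2) yc] \<Psi>y by simp
  with ge have "y \<bullet> v1 = x \<bullet> v2" by simp
  moreover have "(v1 @\<^sub>v v2) \<bullet> g = - (v1 \<bullet> y) + v2 \<bullet> x"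
    unfolding g_def primal_graph_def y_def[symmetric] using v_carrier yc xc
    by (simp add: scalar_prod_append[of _ n _ m])
  ultimately have vg: "(v1 @\<^sub>v v2) \<bullet> g = 0"
    using comm_scalar_prod[OF yc v_carrier(1)] comm_scalar_prod[OF xc v_carrier(2)] by simp
  have gc: "g \<in> carrier_vec (n + m)" unfolding g_def by (rule primal_graph_carrier[OF xc])
  have v_dual: "(v1 @\<^sub>v v2) \<bullet> dual_graph y = 0"
    unfolding dual_y using v_carrier vg gc by simp
  let ?S = "\<lambda>c e. (c * e) \<cdot>\<^sub>m 1\<^sub>m (n + m) + L"
  have ex1: "\<exists>w. 0\<^sub>v m \<le> w \<and> ?S (- 1) e *\<^sub>v primal_graph w = - g"
    if "0 < e" "det (?S (- 1) e) \<noteq> 0" for e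
    using primal_graph_resolvent[OF that x0] vg unfolding g_def by metis
  have ex2: "\<exists>w. 0\<^sub>v n \<le> w \<and> ?S 1 e *\<^sub>v dual_graph w = - g"
    if "0 < e" "det (?S 1 e) \<noteq> 0" for e
    using dual_graph_resolvent[OF that y0 v_dual] unfolding dual_y by metis
  obtain h where h: "h \<in> carrier_vec (n + m)" "L *\<^sub>v h = - g"
    using det_nonzero_solve[OF L, of "- g"] gc by auto
  define w1 where "w1 e = (SOME w. 0\<^sub>v m \<le> w \<and> ?S (- 1) e *\<^sub>v primal_graph w = - g)" for e
  define w2 where "w2 e = (SOME w. 0\<^sub>v n \<le> w \<and> ?S 1 e *\<^sub>v dual_graph w = - g)" for e
  have ev1: "eventually (\<lambda>e. 0\<^sub>v m \<le> w1 e \<and> ?S (- 1) e *\<^sub>v primal_graph (w1 e) = - g) (at_right 0)"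
    using eventually_shift_det_nonzero[OF L, of "- 1"] eventually_at_right_less[of "0 :: real"]
  proof eventually_elim
    case (elim e)
    show ?case unfolding w1_def by (rule someI_ex) (use ex1 elim in blast)
  qed
  have ev2: "eventually (\<lambda>e. 0\<^sub>v n \<le> w2 e \<and> ?S 1 e *\<^sub>v dual_graph (w2 e) = - g) (at_right 0)"
    using eventually_shift_det_nonzero[OF L, of 1] eventually_at_right_less[of "0 :: real"]
  proof eventually_elim
    case (elim e)
    show ?case unfolding w2_def by (rule someI_ex) (use ex2 elim in blast)
  qed
  have lim1: "((\<lambda>e. primal_graph (w1 e) $ i) \<longlongrightarrow> h $ i) (at_right 0)" if "i < n + m" for i
    by (rule shifted_solution_tendsto[OF L _ h(1) that, where c = "- 1"])
      (use ev1 in eventually_elim, use primal_graph_carrier h(2) in \<open>auto simp: zero_le_vec_iff\<close>)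
  have lim2: "((\<lambda>e. dual_graph (w2 e) $ i) \<longlongrightarrow> h $ i) (at_right 0)" if "i < n + m" for i
    by (rule shifted_solution_tendsto[OF L _ h(1) that, where c = 1])
      (use ev2 in eventually_elim, use dual_graph_carrier h(2) in \<open>auto simp: zero_le_vec_iff\<close>)
  have nz: "at_right (0 :: real) \<noteq> bot" by simp
  have \<Phi>T0: "0\<^sub>m n m \<le> \<Phi>\<^sup>T" and \<Psi>T0: "0\<^sub>m m n \<le> \<Psi>\<^sup>T" using \<Phi>_solution \<Psi>_solution by (auto simp: zero_le_mat_iff)
  \<comment> \<open>the first n entries are limits of nonpositive entries from the first family and of nonnegative ones
    from the second; for the last m entries the signs are exchanged\<close>
  have "h $ i = 0" if i: "i < n + m" for i
  proof (cases "i < n")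
    case True
    have "eventually (\<lambda>e. primal_graph (w1 e) $ i \<le> 0) (at_right 0)"
      using ev1
    proof eventually_elim
      case (elim e)
      then have "0\<^sub>v n \<le> \<Phi>\<^sup>T *\<^sub>v w1 e" by (intro zero_le_mult_mat_vec[OF \<Phi>T0]) auto
      then show ?case using True elim carrier_matD[OF \<Phi>_solution(1)]
        by (simp add: primal_graph_def zero_le_vec_iff del: index_mult_mat_vec)
    qed
    moreover have "eventually (\<lambda>e. 0 \<le> dual_graph (w2 e) $ i) (at_right 0)"
      using ev2 by eventually_elim (use True in \<open>auto simp: dual_graph_def zero_le_vec_iff\<close>)
    ultimately show ?thesis
      using tendsto_upperbound[OF lim1[OF i] _ nz] tendsto_lowerbound[OF lim2[OF i] _ nz] by force
  next
    case False
    have "eventually (\<lambda>e. dual_graph (w2 e) $ i \<le> 0) (at_right 0)"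
      using ev2
    proof eventually_elim
      case (elim e)
      have "0\<^sub>v m \<le> \<Psi>\<^sup>T *\<^sub>v w2 e" by (intro zero_le_mult_mat_vec[OF \<Psi>T0]) (use elim in auto)
      moreover have "dim_vec (w2 e) = n" using elim by (simp add: zero_le_vec_iff)
      ultimately show ?case using False i carrier_matD[OF \<Psi>_solution(1)]
        by (simp add: dual_graph_def zero_le_vec_iff del: index_mult_mat_vec)
    qed
    moreover have "eventually (\<lambda>e. 0 \<le> primal_graph (w1 e) $ i) (at_right 0)"
      using ev1 by eventually_elim (use False i solutions_carrier in \<open>auto simp: primal_graph_def zero_le_vec_iff\<close>)
    ultimately show ?thesis
      using tendsto_upperbound[OF lim2[OF i] _ nz] tendsto_lowerbound[OF lim1[OF i] _ nz] by force
  qed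
  then have "h = 0\<^sub>v (n + m)" using h(1) by auto
  moreover have "L *\<^sub>v 0\<^sub>v (n + m) = 0\<^sub>v (n + m)" using L(1) by (intro eq_vecI) auto
  ultimately have "- g = 0\<^sub>v (n + m)" using h(2) by simp
  then have g_0: "- g $ (n + i) = 0" if "i < m" for i
    using that gc by (simp add: vec_eq_iff)
  have "x $ i = 0" if "i < m" for i
    using g_0[OF that] that xc solutions_carrier by (simp add: g_def primal_graph_def)
  then show ?thesis using xc by auto
qed

end

section \<open>Nonsingularity of the two M-matrices\<close>

lemma nonsingular_M_matrix_one_minus:
  assumes N: "0\<^sub>m k k \<le> N" and rho: "real_spectral_radius N < 1"
  shows "nonsingular_M_matrix (1\<^sub>m k - N)"
proof -
  have Nc: "N \<in> carrier_mat k k" using N by (simp add: zero_le_mat_iff)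
  have "Z_splitting (1\<^sub>m k - N) 1 N"
  proof -
    have "dim_row (1\<^sub>m k - N) = k" "1 \<cdot>\<^sub>m 1\<^sub>m k = (1\<^sub>m k :: real mat)" using Nc by auto
    then show ?thesis unfolding Z_splitting_def using N Nc by simp
  qed
  then show ?thesis
    using rho Z_matrix_iff_splitting unfolding nonsingular_M_matrix_def by blast
qed

theorem theorem2:
  fixes A B C D K H \<Phi> \<Psi> :: "real mat"
    and u1 u2 v1 v2 :: "real vec"
    and m n r :: nat
  assumes "m \<ge> 1" and "n \<ge> 1"
    and "A \<in> carrier_mat m m" and "B \<in> carrier_mat m n"
    and "C \<in> carrier_mat n m" and "D \<in> carrier_mat n n"
    and "K = four_block_mat D (- C) (- B) A"
    and "regular_M_matrix K" and "singular_M_matrix K"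
    and "H = four_block_mat (1\<^sub>m n) (0\<^sub>m n m) (0\<^sub>m m n) (- 1\<^sub>m m) * K"
    and "kernel_dim H = 1"
    and "Polynomial.order 0 (char_poly H) = r" and "r \<ge> 1"
    and "u1 \<in> carrier_vec n" and "u2 \<in> carrier_vec m"
    and "v1 \<in> carrier_vec n" and "v2 \<in> carrier_vec m"
    and "0\<^sub>v (n + m) \<le> u1 @\<^sub>v u2" and "u1 @\<^sub>v u2 \<noteq> 0\<^sub>v (n + m)"
    and "0\<^sub>v (n + m) \<le> v1 @\<^sub>v v2" and "v1 @\<^sub>v v2 \<noteq> 0\<^sub>v (n + m)"
    and "K *\<^sub>v (v1 @\<^sub>v v2) = 0\<^sub>v (n + m)"
    and "mat_of_row (u1 @\<^sub>v u2) * K = 0\<^sub>m 1 (n + m)"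
    and "minimal_nonneg_solution m n (\<lambda>X. X * C * X - X * D - A * X + B) \<Phi>"
    and "minimal_nonneg_solution n m (\<lambda>Y. Y * B * Y - Y * A - D * Y + C) \<Psi>"
    and "u1 \<bullet> v1 \<noteq> u2 \<bullet> v2"
  shows "nonsingular_M_matrix (1\<^sub>m m - \<Phi> * \<Psi>) \<and> nonsingular_M_matrix (1\<^sub>m n - \<Psi> * \<Phi>)"
proof -
  note ABCD = assms(3-6) and K_def = assms(7) and H_def = assms(10) and k1 = assms(11)
    and u = assms(14,15) and v = assms(16,17) and \<Phi> = assms(24) and \<Psi> = assms(25)
  have K: "K \<in> carrier_mat (n + m) (n + m)" using ABCD by (simp add: K_def)
  have K_mult: "K *\<^sub>v (f1 @\<^sub>v f2) = (D *\<^sub>v f1 - C *\<^sub>v f2) @\<^sub>v (A *\<^sub>v f2 - B *\<^sub>v f1)"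
    if f: "f1 \<in> carrier_vec n" "f2 \<in> carrier_vec m" for f1 f2
  proof -
    have "K *\<^sub>v (f1 @\<^sub>v f2) = (D *\<^sub>v f1 + - C *\<^sub>v f2) @\<^sub>v (- B *\<^sub>v f1 + A *\<^sub>v f2)"
      unfolding K_def using ABCD f by (intro four_block_mat_mult_vec) auto
    also have "- C *\<^sub>v f2 = - (C *\<^sub>v f2)" using ABCD f by (auto simp: uminus_mult_mat_vec)
    also have "- B *\<^sub>v f1 = - (B *\<^sub>v f1)" using ABCD f by (auto simp: uminus_mult_mat_vec)
    also have "D *\<^sub>v f1 + - (C *\<^sub>v f2) = D *\<^sub>v f1 - C *\<^sub>v f2" using ABCD by (intro eq_vecI) auto
    also have "- (B *\<^sub>v f1) + A *\<^sub>v f2 = A *\<^sub>v f2 - B *\<^sub>v f1" using ABCD by (intro eq_vecI) auto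
    finally show ?thesis .
  qed
  have reg: "Z_matrix K" using assms(8) by (simp add: regular_M_matrix_def M_matrix_def)
  have off: "K $$ (i, j) \<le> 0" if "i < n + m" "j < n + m" "i \<noteq> j" for i j
    using reg that K by (simp add: Z_matrix_def)
  interpret riccati m n A B C D
  proof
    show "A $$ (i, j) \<le> 0" if "i < m" "j < m" "i \<noteq> j" for i j
      using off[of "n + i" "n + j"] that ABCD by (simp add: K_def)
    show "D $$ (i, j) \<le> 0" if "i < n" "j < n" "i \<noteq> j" for i j
      using off[of i j] that ABCD by (simp add: K_def)
    show "0\<^sub>m m n \<le> B"
      unfolding zero_le_mat_iff
    proof (intro conjI allI impI)
      fix i j assume "i < m" "j < n"
      then show "0 \<le> B $$ (i, j)" using off[of "n + i" j] ABCD by (simp add: K_def)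
    qed (use ABCD in auto)
    show "0\<^sub>m n m \<le> C"
      unfolding zero_le_mat_iff
    proof (intro conjI allI impI)
      fix i j assume "i < n" "j < m"
      then show "0 \<le> C $$ (i, j)" using off[of i "n + j"] ABCD by (simp add: K_def)
    qed (use ABCD in auto)
  qed (use ABCD in auto)
  obtain q where q: "q \<in> carrier_vec (n + m)" "\<And>i. i < n + m \<Longrightarrow> 0 < q $ i" "0\<^sub>v (n + m) \<le> K *\<^sub>v q"
    using assms(8) K by (auto simp: regular_M_matrix_def)
  obtain q1 q2 where q12: "q = q1 @\<^sub>v q2" "q1 \<in> carrier_vec n" "q2 \<in> carrier_vec m"
    using vec_first_last_append[OF q(1)] by (metis vec_first_carrier vec_last_carrier)
  have q1: "0 < q1 $ i" if "i < n" for i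
    using q(2)[of i] that q12 by simp
  have q2: "0 < q2 $ i" if "i < m" for i
    using q(2)[of "n + i"] that q12 by simp
  have Kq: "0\<^sub>v (n + m) \<le> (D *\<^sub>v q1 - C *\<^sub>v q2) @\<^sub>v (A *\<^sub>v q2 - B *\<^sub>v q1)"
    using q(3) K_mult[OF q12(2,3)] q12(1) by simp
  have split0: "0\<^sub>v n \<le> a \<and> 0\<^sub>v m \<le> b"
    if le: "0\<^sub>v (n + m) \<le> a @\<^sub>v b" and c: "a \<in> carrier_vec n" "b \<in> carrier_vec m" for a b :: "real vec"
  proof -
    have ent: "0 \<le> (a @\<^sub>v b) $ i" if "i < n + m" for i using le that by (simp add: zero_le_vec_iff)
    have "0 \<le> a $ i" if "i < n" for i using ent[of i] that c by simp
    moreover have "0 \<le> b $ i" if "i < m" for i using ent[of "n + i"] that c by simp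
    ultimately show ?thesis using c by (simp add: zero_le_vec_iff)
  qed
  have diff_le: "y \<le> x" if "0\<^sub>v k \<le> x - y" "x \<in> carrier_vec k" "y \<in> carrier_vec k" for x y :: "real vec" and k
    using that by (auto simp: less_eq_vec_def)
  have "0\<^sub>v n \<le> D *\<^sub>v q1 - C *\<^sub>v q2" "0\<^sub>v m \<le> A *\<^sub>v q2 - B *\<^sub>v q1"
    using split0[OF Kq] ABCD q12 by auto
  then have K1: "C *\<^sub>v q2 \<le> D *\<^sub>v q1" and K2: "B *\<^sub>v q1 \<le> A *\<^sub>v q2"
    using ABCD q12 diff_le[of n "D *\<^sub>v q1" "C *\<^sub>v q2"] diff_le[of m "A *\<^sub>v q2" "B *\<^sub>v q1"] by simp_all
  have v0: "0\<^sub>v n \<le> v1" "0\<^sub>v m \<le> v2" using split0[OF assms(20) v] by auto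
  have eq0: "x = y" if "x - y = 0\<^sub>v k" "x \<in> carrier_vec k" "y \<in> carrier_vec k" for x y :: "real vec" and k
  proof (rule eq_vecI)
    fix i assume "i < dim_vec y"
    then show "x $ i = y $ i" using arg_cong[OF that(1), of "\<lambda>u. u $ i"] that(2,3) by simp
  qed (use that in auto)
  have zsplit: "a = 0\<^sub>v n \<and> b = 0\<^sub>v m"
    if "a @\<^sub>v b = 0\<^sub>v (n + m)" "a \<in> carrier_vec n" "b \<in> carrier_vec m" for a b :: "real vec"
  proof -
    have "0\<^sub>v (n + m) = 0\<^sub>v n @\<^sub>v (0\<^sub>v m :: real vec)" by auto
    then show ?thesis using that append_vec_eq[of a n "0\<^sub>v n" b "0\<^sub>v m"] by simp
  qed
  have "D *\<^sub>v v1 - C *\<^sub>v v2 = 0\<^sub>v n \<and> A *\<^sub>v v2 - B *\<^sub>v v1 = 0\<^sub>v m"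
    using assms(22) K_mult[OF v] ABCD v by (intro zsplit) auto
  then have Kv: "D *\<^sub>v v1 = C *\<^sub>v v2" "A *\<^sub>v v2 = B *\<^sub>v v1"
    using ABCD v eq0[of "D *\<^sub>v v1" "C *\<^sub>v v2" n] eq0[of "A *\<^sub>v v2" "B *\<^sub>v v1" m] by simp_all
  have H_eq: "H = four_block_mat D (- C) B (- A)"
  proof -
    have neg0: "- 0\<^sub>m a b = (0\<^sub>m a b :: real mat)" for a b by (intro eq_matI) auto
    have "H = four_block_mat (1\<^sub>m n * D + 0\<^sub>m n m * - B) (1\<^sub>m n * - C + 0\<^sub>m n m * A)
        (0\<^sub>m m n * D + - 1\<^sub>m m * - B) (0\<^sub>m m n * - C + - 1\<^sub>m m * A)"
      unfolding H_def K_def using ABCD by (intro mult_four_block_mat) auto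
    also have "1\<^sub>m n * D + 0\<^sub>m n m * - B = D" using ABCD by (simp add: neg0)
    also have "1\<^sub>m n * - C + 0\<^sub>m n m * A = - C" using ABCD by (simp add: neg0)
    also have "0\<^sub>m m n * D + - 1\<^sub>m m * - B = B" using ABCD by (simp add: neg0)
    also have "0\<^sub>m m n * - C + - 1\<^sub>m m * A = - A" using ABCD by (simp add: neg0)
    finally show ?thesis .
  qed
  have H: "H \<in> carrier_mat (n + m) (n + m)" using ABCD by (simp add: H_eq)
  have H_transpose: "H\<^sup>T = hamiltonian_transpose"
    unfolding H_eq hamiltonian_transpose_def using ABCD
    by (subst transpose_four_block_mat[of _ n n _ m _ m]) (auto simp: transpose_uminus)
  let ?v = "v1 @\<^sub>v v2" and ?u = "u1 @\<^sub>v (- u2)"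
  have vc: "?v \<in> carrier_vec (n + m)" and uc: "?u \<in> carrier_vec (n + m)" using u v by auto
  have Hv: "H *\<^sub>v ?v = 0\<^sub>v (n + m)"
    unfolding H_def using K assms(22) by (subst assoc_mult_mat_vec[of _ "n + m" "n + m"]) (auto simp: vc)
  have uK: "K\<^sup>T *\<^sub>v (u1 @\<^sub>v u2) = 0\<^sub>v (n + m)"
  proof (rule eq_vecI)
    fix i assume "i < dim_vec (0\<^sub>v (n + m) :: real vec)"
    then have i: "i < n + m" by simp
    have "(K\<^sup>T *\<^sub>v (u1 @\<^sub>v u2)) $ i = col K i \<bullet> (u1 @\<^sub>v u2)" using i K by simp
    also have "\<dots> = (u1 @\<^sub>v u2) \<bullet> col K i" using K i u by (intro comm_scalar_prod[of _ "n + m"]) auto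
    also have "\<dots> = (mat_of_row (u1 @\<^sub>v u2) * K) $$ (0, i)" using i K by simp
    finally show "(K\<^sup>T *\<^sub>v (u1 @\<^sub>v u2)) $ i = 0\<^sub>v (n + m) $ i" using i assms(23) by simp
  qed (use K in auto)
  \<comment> \<open>the signature matrix S with H = S K is symmetric and sends (u1, -u2) to (u1, u2)\<close>
  have HTu: "H\<^sup>T *\<^sub>v ?u = 0\<^sub>v (n + m)"
  proof -
    let ?S = "four_block_mat (1\<^sub>m n) (0\<^sub>m n m) (0\<^sub>m m n) (- 1\<^sub>m m) :: real mat"
    have S: "?S \<in> carrier_mat (n + m) (n + m)" by simp
    have "?S\<^sup>T = ?S"
      by (subst transpose_four_block_mat[of _ n n _ m _ m]) (auto simp: transpose_uminus)
    moreover have "?S *\<^sub>v ?u = u1 @\<^sub>v u2"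
      using u by (subst mult_mat_vec_split[of _ n _ m]) (auto simp: uminus_mult_mat_vec)
    ultimately have "?S\<^sup>T *\<^sub>v ?u = u1 @\<^sub>v u2" by simp
    moreover have "H\<^sup>T *\<^sub>v ?u = K\<^sup>T *\<^sub>v (?S\<^sup>T *\<^sub>v ?u)"
      unfolding H_def transpose_mult[OF S K] using S K uc
      by (intro assoc_mult_mat_vec[of _ "n + m" "n + m" _ "n + m"]) auto
    ultimately show ?thesis using uK by simp
  qed
  \<comment> \<open>the left and right null vectors of H are not orthogonal, so H can be deflated\<close>
  have "?u \<bullet> ?v = u1 \<bullet> v1 - u2 \<bullet> v2"
    using u v by (simp add: scalar_prod_append[of _ n _ m])
  then have uv: "?u \<bullet> ?v \<noteq> 0" using assms(26) by simp
  define L where "L = (H + outer_prod ?v ?u)\<^sup>T"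
  have P: "outer_prod ?v ?u \<in> carrier_mat (n + m) (n + m)" by (rule outer_prod_carrier[OF vc uc])
  have L: "L \<in> carrier_mat (n + m) (n + m)" using H P by (simp add: L_def)
  have "det L = det (H + outer_prod ?v ?u)" unfolding L_def using H P by (intro det_transpose) auto
  then have det: "det L \<noteq> 0"
    using simple_kernel_rank_one_update_det[OF H k1 vc assms(21) Hv uc HTu uv] by simp
  have LG: "L *\<^sub>v f = hamiltonian_transpose *\<^sub>v f"
    if f: "f \<in> carrier_vec (n + m)" and vf: "?v \<bullet> f = 0" for f
  proof -
    have "L = hamiltonian_transpose + outer_prod ?u ?v"
      unfolding L_def using transpose_add[OF H P] by (simp add: H_transpose transpose_outer_prod)
    moreover note hamiltonian_transpose_carrier
    moreover have "(0::real) \<cdot>\<^sub>v ?u = 0\<^sub>v (n + m)" using u by (intro eq_vecI) simp_all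
    ultimately show ?thesis
      using f vf outer_prod_mult_vec[OF vc f, of ?u] outer_prod_carrier[OF uc vc]
      by (simp add: add_mult_distrib_mat_vec[of _ "n + m" "n + m"])
  qed
  interpret riccati_solutions m n A B C D \<Phi> \<Psi> L q1 q2 v1 v2
    by unfold_locales (use \<Phi> \<Psi> q12 q1 q2 K1 K2 v0 Kv L det LG in auto)
  note \<Phi>c = \<Phi>_solution(1,2) and \<Psi>c = \<Psi>_solution(1,2) and core = nonneg_left_fixed_vector_eq_zero
    and q0 = q_nonneg
  have \<Phi>q: "\<Phi> *\<^sub>v q1 \<le> q2" by (rule minimal_solution_mult_vec_le[OF \<Phi> q12(2) q0(2) K1 K2])
  have \<Psi>q: "\<Psi> *\<^sub>v q2 \<le> q1" by (rule dual.minimal_solution_mult_vec_le[OF \<Psi> q12(3) q0(1) K2 K1])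
  have "real_spectral_radius (\<Phi> * \<Psi>) < 1"
  proof (rule ccontr)
    assume "\<not> real_spectral_radius (\<Phi> * \<Psi>) < 1"
    moreover have "\<Phi> *\<^sub>v (\<Psi> *\<^sub>v q2) \<le> q2"
      using mult_mat_vec_mono[OF \<Phi>c(2) _ \<Psi>q] \<Phi>q \<Psi>c q12 by (auto intro: order_trans)
    then have "(\<Phi> * \<Psi>) *\<^sub>v q2 \<le> q2" using \<Phi>c \<Psi>c q12 by simp
    ultimately obtain x where x: "0\<^sub>v m \<le> x" "x \<noteq> 0\<^sub>v m" "(\<Phi> * \<Psi>)\<^sup>T *\<^sub>v x = x"
      using left_fixed_vector_if_spectral_radius_ge_1[of m "\<Phi> * \<Psi>" q2] zero_le_mult_mat[OF \<Phi>c(2) \<Psi>c(2)]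
        assms(1) q12(3) q2 by (auto simp: not_less)
    have "\<Psi>\<^sup>T *\<^sub>v (\<Phi>\<^sup>T *\<^sub>v x) = (\<Psi>\<^sup>T * \<Phi>\<^sup>T) *\<^sub>v x"
      using x(1) \<Phi>c(1) \<Psi>c(1)
      by (intro assoc_mult_mat_vec[symmetric, of _ m n _ m]) (simp_all add: zero_le_vec_iff)
    also have "\<dots> = x" using x(3) unfolding transpose_mult[OF \<Phi>c(1) \<Psi>c(1)] .
    finally have "\<Psi>\<^sup>T *\<^sub>v (\<Phi>\<^sup>T *\<^sub>v x) = x" .
    with core x show False by blast
  qed
  moreover have "real_spectral_radius (\<Psi> * \<Phi>) < 1"
  proof (rule ccontr)
    assume "\<not> real_spectral_radius (\<Psi> * \<Phi>) < 1"
    moreover have "\<Psi> *\<^sub>v (\<Phi> *\<^sub>v q1) \<le> q1"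
      using mult_mat_vec_mono[OF \<Psi>c(2) _ \<Phi>q] \<Psi>q \<Phi>c q12 by (auto intro: order_trans)
    then have "(\<Psi> * \<Phi>) *\<^sub>v q1 \<le> q1" using \<Phi>c \<Psi>c q12 by simp
    ultimately obtain y where y: "0\<^sub>v n \<le> y" "y \<noteq> 0\<^sub>v n" "(\<Psi> * \<Phi>)\<^sup>T *\<^sub>v y = y"
      using left_fixed_vector_if_spectral_radius_ge_1[of n "\<Psi> * \<Phi>" q1] zero_le_mult_mat[OF \<Psi>c(2) \<Phi>c(2)]
        assms(2) q12(2) q1 by (auto simp: not_less)
    have yc: "y \<in> carrier_vec n" using y by (simp add: zero_le_vec_iff)
    have "\<Phi>\<^sup>T *\<^sub>v (\<Psi>\<^sup>T *\<^sub>v y) = (\<Phi>\<^sup>T * \<Psi>\<^sup>T) *\<^sub>v y"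
      using yc \<Phi>c(1) \<Psi>c(1) by (intro assoc_mult_mat_vec[symmetric, of _ n m _ n]) simp_all
    also have "\<dots> = y" using y(3) unfolding transpose_mult[OF \<Psi>c(1) \<Phi>c(1)] .
    finally have fixy: "\<Phi>\<^sup>T *\<^sub>v (\<Psi>\<^sup>T *\<^sub>v y) = y" .
    have "0\<^sub>v m \<le> \<Psi>\<^sup>T *\<^sub>v y"
      using \<Psi>c y(1) by (intro zero_le_mult_mat_vec[where k = n]) (auto simp: zero_le_mat_iff)
    \<comment> \<open>the image of a left fixed vector of one product is a left fixed vector of the other\<close>
    then have "\<Psi>\<^sup>T *\<^sub>v y = 0\<^sub>v m" by (rule core) (simp only: fixy)
    moreover have "\<Phi>\<^sup>T *\<^sub>v 0\<^sub>v m = 0\<^sub>v n" using \<Phi>c by auto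
    ultimately have "y = 0\<^sub>v n" using fixy by simp
    with y show False by simp
  qed
  ultimately show ?thesis
    using nonsingular_M_matrix_one_minus zero_le_mult_mat[OF \<Phi>c(2) \<Psi>c(2)] zero_le_mult_mat[OF \<Psi>c(2) \<Phi>c(2)]
    by blast
qed

end
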